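(* Suppose that $P$ and $Q$ are groups, $R\leqslant P$ is a retract of $P$, $S\leqslant Q$ is a retract of $Q$, $\varphi:R\to S$ is an isomorphism, and $G=P*_{R=S}Q=\langle P,Q \,\|\, r=\varphi(r)\ \forall\, r\in R\rangle$ is the corresponding amalgamated free product. If $P$ and $Q$ have property (VRC), then $G$ also has property (VRC).
   Context: A subgroup $H$ of a group $K$ is a retract of $K$ if there is a homomorphism $\rho: K \to H$ which restricts to the identity map on $H$. A subgroup $H$ of a group $G$ is a virtual retract of $G$ if there exists a subgroup $K \leqslant G$ with $|G:K|<\infty$, $H \subseteq K$, and $H$ a retract of $K$. A group $G$ has property (VRC) if every cyclic subgroup of $G$ is a virtual retract of $G$. *)

theory Defs
  imports "HOL-Algebra.Elementary_Groups"
begin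

section \<open>Virtual retracts and property (VRC)\<close>

definition group_retract :: "'a set \<Rightarrow> ('a, 'm) monoid_scheme \<Rightarrow> bool" where
  "group_retract H K \<longleftrightarrow>
     subgroup H K \<and> (\<exists>\<rho> \<in> hom K (K\<lparr>carrier := H\<rparr>). \<forall>h \<in> H. \<rho> h = h)"

text \<open>The index is finite iff there are finitely many cosets; the cardinality of \<^term>\<open>rcosets\<^bsub>G\<^esub> K\<close>
  would not do, as it is \<open>0\<close> for infinite index.\<close>

definition virtual_retract :: "'a set \<Rightarrow> ('a, 'm) monoid_scheme \<Rightarrow> bool" where
  "virtual_retract H G \<longleftrightarrow>
     subgroup H G \<and>
     (\<exists>K. subgroup K G \<and> finite (rcosets\<^bsub>G\<^esub> K) \<and> H \<subseteq> K \<and>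
          group_retract H (G\<lparr>carrier := K\<rparr>))"

definition has_VRC :: "('a, 'm) monoid_scheme \<Rightarrow> bool" where
  "has_VRC G \<longleftrightarrow>
     group G \<and>
     (\<forall>C. subgroup C G \<longrightarrow> cyclic_group (G\<lparr>carrier := C\<rparr>) \<longrightarrow> virtual_retract C G)"


section \<open>Amalgamated free products\<close>

text \<open>The group \<open>\<langle>P, Q \<parallel> r = \<phi> r for all r \<in> R\<rangle>\<close> is built from words whose letters are elements of \<open>P\<close>
  (tagged \<^const>\<open>Inl\<close>) or of \<open>Q\<close> (tagged \<^const>\<open>Inr\<close>), modulo the least congruence containing the
  multiplication tables of \<open>P\<close> and \<open>Q\<close> and the amalgamating relations. Formal inverses of letters
  are not needed, since every letter is inverse to a letter of the same factor.\<close>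

abbreviation amalg_words ::
  "('a, 'm) monoid_scheme \<Rightarrow> ('b, 'n) monoid_scheme \<Rightarrow> ('a + 'b) list set" where
  "amalg_words P Q \<equiv> lists (carrier P <+> carrier Q)"

inductive_set amalg_rel ::
  "('a, 'm) monoid_scheme \<Rightarrow> ('b, 'n) monoid_scheme \<Rightarrow> 'a set \<Rightarrow> ('a \<Rightarrow> 'b) \<Rightarrow>
     (('a + 'b) list \<times> ('a + 'b) list) set"
  for P :: "('a, 'm) monoid_scheme" and Q :: "('b, 'n) monoid_scheme"
    and R :: "'a set" and \<phi> :: "'a \<Rightarrow> 'b"
where
  refl: "w \<in> amalg_words P Q \<Longrightarrow> (w, w) \<in> amalg_rel P Q R \<phi>"
| sym: "(u, v) \<in> amalg_rel P Q R \<phi> \<Longrightarrow> (v, u) \<in> amalg_rel P Q R \<phi>"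
| trans: "(u, v) \<in> amalg_rel P Q R \<phi> \<Longrightarrow> (v, w) \<in> amalg_rel P Q R \<phi> \<Longrightarrow>
    (u, w) \<in> amalg_rel P Q R \<phi>"
| append: "(u, u') \<in> amalg_rel P Q R \<phi> \<Longrightarrow> (v, v') \<in> amalg_rel P Q R \<phi> \<Longrightarrow>
    (u @ v, u' @ v') \<in> amalg_rel P Q R \<phi>"
| one_left: "([Inl \<one>\<^bsub>P\<^esub>], []) \<in> amalg_rel P Q R \<phi>"
| one_right: "([Inr \<one>\<^bsub>Q\<^esub>], []) \<in> amalg_rel P Q R \<phi>"
| mult_left: "x \<in> carrier P \<Longrightarrow> y \<in> carrier P \<Longrightarrow>
    ([Inl x, Inl y], [Inl (x \<otimes>\<^bsub>P\<^esub> y)]) \<in> amalg_rel P Q R \<phi>"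
| mult_right: "x \<in> carrier Q \<Longrightarrow> y \<in> carrier Q \<Longrightarrow>
    ([Inr x, Inr y], [Inr (x \<otimes>\<^bsub>Q\<^esub> y)]) \<in> amalg_rel P Q R \<phi>"
| amalg: "r \<in> R \<Longrightarrow> ([Inl r], [Inr (\<phi> r)]) \<in> amalg_rel P Q R \<phi>"

definition amalg_free_product ::
  "('a, 'm) monoid_scheme \<Rightarrow> ('b, 'n) monoid_scheme \<Rightarrow> 'a set \<Rightarrow> ('a \<Rightarrow> 'b) \<Rightarrow>
     ('a + 'b) list set monoid" where
  "amalg_free_product P Q R \<phi> =
     \<lparr>carrier = amalg_words P Q // amalg_rel P Q R \<phi>,
      monoid.mult = (\<lambda>A B. \<Union>u \<in> A. \<Union>v \<in> B. amalg_rel P Q R \<phi> `` {u @ v}),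
      one = amalg_rel P Q R \<phi> `` {[]}\<rparr>"

text \<open>The construction is a group with the universal property of the pushout of
  \<open>P \<leftarrow> R \<rightarrow> Q\<close>.\<close>

context
  fixes P :: "('a, 'm) monoid_scheme" and Q :: "('b, 'n) monoid_scheme"
    and R :: "'a set" and \<phi> :: "'a \<Rightarrow> 'b"
  assumes P: "group P" and Q: "group Q"
    and R: "R \<subseteq> carrier P" and \<phi>: "\<phi> \<in> R \<rightarrow> carrier Q"
begin

interpretation P: group P by (rule P)
interpretation Q: group Q by (rule Q)

lemma amalg_rel_words:
  "(u, v) \<in> amalg_rel P Q R \<phi> \<Longrightarrow> u \<in> amalg_words P Q \<and> v \<in> amalg_words P Q"
  by (induction rule: amalg_rel.induct) (use R \<phi> in auto)

lemma equiv_amalg_rel: "equiv (amalg_words P Q) (amalg_rel P Q R \<phi>)"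
proof (rule equivI)
  show "amalg_rel P Q R \<phi> \<subseteq> amalg_words P Q \<times> amalg_words P Q"
    using amalg_rel_words by auto
  show "refl_on (amalg_words P Q) (amalg_rel P Q R \<phi>)"
    by (rule refl_onI) (rule amalg_rel.refl)
  show "sym (amalg_rel P Q R \<phi>)"
    by (rule symI) (rule amalg_rel.sym)
  show "trans (amalg_rel P Q R \<phi>)"
    by (rule transI) (rule amalg_rel.trans)
qed

lemma amalg_class_eq_iff:
  assumes "u \<in> amalg_words P Q" "v \<in> amalg_words P Q"
  shows "amalg_rel P Q R \<phi> `` {u} = amalg_rel P Q R \<phi> `` {v} \<longleftrightarrow> (u, v) \<in> amalg_rel P Q R \<phi>"
  using eq_equiv_class_iff[OF equiv_amalg_rel assms] .

lemma amalg_mult_class: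
  assumes "u \<in> amalg_words P Q" "v \<in> amalg_words P Q"
  shows "amalg_rel P Q R \<phi> `` {u} \<otimes>\<^bsub>amalg_free_product P Q R \<phi>\<^esub> amalg_rel P Q R \<phi> `` {v}
           = amalg_rel P Q R \<phi> `` {u @ v}"
proof -
  have "congruent2 (amalg_rel P Q R \<phi>) (amalg_rel P Q R \<phi>)
          (\<lambda>u v. amalg_rel P Q R \<phi> `` {u @ v})"
    by (rule congruent2I') (rule equiv_class_eq[OF equiv_amalg_rel amalg_rel.append])
  from UN_equiv_class2[OF equiv_amalg_rel equiv_amalg_rel this assms]
  show ?thesis by (simp add: amalg_free_product_def)
qed

lemma amalg_carrier:
  "carrier (amalg_free_product P Q R \<phi>) = (\<lambda>w. amalg_rel P Q R \<phi> `` {w}) ` amalg_words P Q"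
  by (auto simp: amalg_free_product_def quotient_def)

lemma amalg_one: "\<one>\<^bsub>amalg_free_product P Q R \<phi>\<^esub> = amalg_rel P Q R \<phi> `` {[]}"
  by (simp add: amalg_free_product_def)

lemma amalg_left_inverse:
  "w \<in> amalg_words P Q \<Longrightarrow> \<exists>v \<in> amalg_words P Q. (v @ w, []) \<in> amalg_rel P Q R \<phi>"
proof (induction w)
  case Nil
  then show ?case by (intro bexI[of _ "[]"]) (simp_all add: amalg_rel.refl)
next
  case (Cons x w)
  then obtain v where v: "v \<in> amalg_words P Q" "(v @ w, []) \<in> amalg_rel P Q R \<phi>"
    by auto
  have w: "w \<in> amalg_words P Q" using Cons.prems by auto
  obtain y where y: "y \<in> carrier P <+> carrier Q" "([y] @ [x], []) \<in> amalg_rel P Q R \<phi>"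
  proof (cases x)
    case (Inl p)
    then have "p \<in> carrier P" using Cons.prems by auto
    then have "([Inl (inv\<^bsub>P\<^esub> p)] @ [x], [Inl \<one>\<^bsub>P\<^esub>]) \<in> amalg_rel P Q R \<phi>"
      using amalg_rel.mult_left[of "inv\<^bsub>P\<^esub> p" P p] Inl by simp
    then have "([Inl (inv\<^bsub>P\<^esub> p)] @ [x], []) \<in> amalg_rel P Q R \<phi>"
      by (rule amalg_rel.trans[OF _ amalg_rel.one_left])
    with \<open>p \<in> carrier P\<close> show ?thesis by (intro that) auto
  next
    case (Inr q)
    then have "q \<in> carrier Q" using Cons.prems by auto
    then have "([Inr (inv\<^bsub>Q\<^esub> q)] @ [x], [Inr \<one>\<^bsub>Q\<^esub>]) \<in> amalg_rel P Q R \<phi>"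
      using amalg_rel.mult_right[of "inv\<^bsub>Q\<^esub> q" Q q] Inr by simp
    then have "([Inr (inv\<^bsub>Q\<^esub> q)] @ [x], []) \<in> amalg_rel P Q R \<phi>"
      by (rule amalg_rel.trans[OF _ amalg_rel.one_right])
    with \<open>q \<in> carrier Q\<close> show ?thesis by (intro that) auto
  qed
  have "(v @ ([y] @ [x]) @ w, v @ [] @ w) \<in> amalg_rel P Q R \<phi>"
    by (intro amalg_rel.append amalg_rel.refl y v w)
  then have "((v @ [y]) @ x # w, v @ w) \<in> amalg_rel P Q R \<phi>" by simp
  then have "((v @ [y]) @ x # w, []) \<in> amalg_rel P Q R \<phi>"
    using v(2) by (rule amalg_rel.trans)
  then show ?case using v(1) y(1) by (intro bexI[of _ "v @ [y]"]) auto
qed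

lemma group_amalg_free_product: "group (amalg_free_product P Q R \<phi>)"
proof (rule groupI)
  fix x y assume "x \<in> carrier (amalg_free_product P Q R \<phi>)" "y \<in> carrier (amalg_free_product P Q R \<phi>)"
  then obtain u v where "u \<in> amalg_words P Q" "x = amalg_rel P Q R \<phi> `` {u}"
    "v \<in> amalg_words P Q" "y = amalg_rel P Q R \<phi> `` {v}"
    unfolding amalg_carrier by blast
  then show "x \<otimes>\<^bsub>amalg_free_product P Q R \<phi>\<^esub> y \<in> carrier (amalg_free_product P Q R \<phi>)"
    by (simp only: amalg_mult_class amalg_carrier) (intro imageI, simp)
next
  show "\<one>\<^bsub>amalg_free_product P Q R \<phi>\<^esub> \<in> carrier (amalg_free_product P Q R \<phi>)"
    unfolding amalg_one amalg_carrier by (intro imageI) simp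
next
  fix x y z assume "x \<in> carrier (amalg_free_product P Q R \<phi>)" "y \<in> carrier (amalg_free_product P Q R \<phi>)"
    "z \<in> carrier (amalg_free_product P Q R \<phi>)"
  then obtain u v w where "u \<in> amalg_words P Q" "x = amalg_rel P Q R \<phi> `` {u}"
    "v \<in> amalg_words P Q" "y = amalg_rel P Q R \<phi> `` {v}"
    "w \<in> amalg_words P Q" "z = amalg_rel P Q R \<phi> `` {w}"
    unfolding amalg_carrier by blast
  then show "x \<otimes>\<^bsub>amalg_free_product P Q R \<phi>\<^esub> y \<otimes>\<^bsub>amalg_free_product P Q R \<phi>\<^esub> z
      = x \<otimes>\<^bsub>amalg_free_product P Q R \<phi>\<^esub> (y \<otimes>\<^bsub>amalg_free_product P Q R \<phi>\<^esub> z)"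
    by (simp add: amalg_mult_class)
next
  fix x assume "x \<in> carrier (amalg_free_product P Q R \<phi>)"
  then obtain w where "w \<in> amalg_words P Q" "x = amalg_rel P Q R \<phi> `` {w}"
    unfolding amalg_carrier by blast
  then show "\<one>\<^bsub>amalg_free_product P Q R \<phi>\<^esub> \<otimes>\<^bsub>amalg_free_product P Q R \<phi>\<^esub> x = x"
    by (simp add: amalg_one amalg_mult_class)
next
  fix x assume "x \<in> carrier (amalg_free_product P Q R \<phi>)"
  then obtain w where w: "w \<in> amalg_words P Q" "x = amalg_rel P Q R \<phi> `` {w}"
    by (auto simp: amalg_carrier)
  obtain v where v: "v \<in> amalg_words P Q" "(v @ w, []) \<in> amalg_rel P Q R \<phi>"
    using amalg_left_inverse[OF w(1)] by blast
  show "\<exists>y \<in> carrier (amalg_free_product P Q R \<phi>).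
          y \<otimes>\<^bsub>amalg_free_product P Q R \<phi>\<^esub> x = \<one>\<^bsub>amalg_free_product P Q R \<phi>\<^esub>"
  proof
    show "amalg_rel P Q R \<phi> `` {v} \<otimes>\<^bsub>amalg_free_product P Q R \<phi>\<^esub> x
            = \<one>\<^bsub>amalg_free_product P Q R \<phi>\<^esub>"
      unfolding w(2) amalg_mult_class[OF v(1) w(1)] amalg_one
      using v(2) by (rule equiv_class_eq[OF equiv_amalg_rel])
  qed (use v(1) in \<open>simp add: amalg_carrier\<close>)
qed

lemma hom_amalg_left:
  "(\<lambda>x. amalg_rel P Q R \<phi> `` {[Inl x]}) \<in> hom P (amalg_free_product P Q R \<phi>)"
proof (rule homI)
  fix x y assume "x \<in> carrier P" "y \<in> carrier P"
  then show "amalg_rel P Q R \<phi> `` {[Inl (x \<otimes>\<^bsub>P\<^esub> y)]}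
      = amalg_rel P Q R \<phi> `` {[Inl x]} \<otimes>\<^bsub>amalg_free_product P Q R \<phi>\<^esub> amalg_rel P Q R \<phi> `` {[Inl y]}"
    using equiv_class_eq[OF equiv_amalg_rel amalg_rel.mult_left, of x y]
      amalg_mult_class[of "[Inl x]" "[Inl y]"] by (simp add: Plus_def)
qed (auto simp: amalg_carrier)

lemma hom_amalg_right:
  "(\<lambda>x. amalg_rel P Q R \<phi> `` {[Inr x]}) \<in> hom Q (amalg_free_product P Q R \<phi>)"
proof (rule homI)
  fix x y assume "x \<in> carrier Q" "y \<in> carrier Q"
  then show "amalg_rel P Q R \<phi> `` {[Inr (x \<otimes>\<^bsub>Q\<^esub> y)]}
      = amalg_rel P Q R \<phi> `` {[Inr x]} \<otimes>\<^bsub>amalg_free_product P Q R \<phi>\<^esub> amalg_rel P Q R \<phi> `` {[Inr y]}"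
    using equiv_class_eq[OF equiv_amalg_rel amalg_rel.mult_right, of x y]
      amalg_mult_class[of "[Inr x]" "[Inr y]"] by (simp add: Plus_def)
qed (auto simp: amalg_carrier)

lemma amalg_identified:
  "r \<in> R \<Longrightarrow> amalg_rel P Q R \<phi> `` {[Inl r]} = amalg_rel P Q R \<phi> `` {[Inr (\<phi> r)]}"
  by (rule equiv_class_eq[OF equiv_amalg_rel amalg_rel.amalg])

theorem amalg_universal_exists:
  fixes H :: "('c, 'k) monoid_scheme"
  assumes H: "group H" and f: "f \<in> hom P H" and g: "g \<in> hom Q H"
    and fg: "\<And>r. r \<in> R \<Longrightarrow> f r = g (\<phi> r)"
  shows "\<exists>h \<in> hom (amalg_free_product P Q R \<phi>) H.
           (\<forall>x \<in> carrier P. h (amalg_rel P Q R \<phi> `` {[Inl x]}) = f x) \<and>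
           (\<forall>y \<in> carrier Q. h (amalg_rel P Q R \<phi> `` {[Inr y]}) = g y)"
proof -
  interpret H: group H by (rule H)
  interpret f: group_hom P H f using f by unfold_locales
  interpret g: group_hom Q H g using g by unfold_locales
  define ev where "ev w = foldr (\<lambda>x a. case_sum f g x \<otimes>\<^bsub>H\<^esub> a) w \<one>\<^bsub>H\<^esub>" for w
  have ev_Nil [simp]: "ev [] = \<one>\<^bsub>H\<^esub>"
    and ev_Cons [simp]: "ev (x # w) = case_sum f g x \<otimes>\<^bsub>H\<^esub> ev w" for x w
    by (simp_all add: ev_def)
  have letter: "case_sum f g x \<in> carrier H" if "x \<in> carrier P <+> carrier Q" for x
    using that by auto
  have ev_closed: "ev w \<in> carrier H" if "w \<in> amalg_words P Q" for w
    using that by (induction w) (auto simp: letter)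
  have ev_append: "ev (u @ v) = ev u \<otimes>\<^bsub>H\<^esub> ev v"
    if "u \<in> amalg_words P Q" "v \<in> amalg_words P Q" for u v
    using that by (induction u) (auto simp: ev_closed H.m_assoc letter)
  have ev_cong: "ev u = ev v" if "(u, v) \<in> amalg_rel P Q R \<phi>" for u v
    using that
  proof (induction rule: amalg_rel.induct)
    case (append u u' v v')
    then show ?case
      using amalg_rel_words[of u u'] amalg_rel_words[of v v'] ev_append[of u v] ev_append[of u' v']
      by (simp only:)
  next
    case (amalg r)
    then show ?case by (simp add: fg)
  qed (auto simp: H.m_assoc)
  define h where "h A = ev (SOME w. w \<in> A)" for A
  have h: "h (amalg_rel P Q R \<phi> `` {w}) = ev w" if "w \<in> amalg_words P Q" for w
  proof -
    have "w \<in> amalg_rel P Q R \<phi> `` {w}" using that by (auto intro: amalg_rel.refl)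
    then have "(SOME v. v \<in> amalg_rel P Q R \<phi> `` {w}) \<in> amalg_rel P Q R \<phi> `` {w}"
      by (rule someI)
    then have "(w, SOME v. v \<in> amalg_rel P Q R \<phi> `` {w}) \<in> amalg_rel P Q R \<phi>" by blast
    then show ?thesis unfolding h_def by (metis ev_cong)
  qed
  show ?thesis
  proof (rule bexI)
    show "h \<in> hom (amalg_free_product P Q R \<phi>) H"
    proof (rule homI)
      fix A assume "A \<in> carrier (amalg_free_product P Q R \<phi>)"
      then obtain u where "u \<in> amalg_words P Q" "A = amalg_rel P Q R \<phi> `` {u}"
        unfolding amalg_carrier by blast
      then show "h A \<in> carrier H" by (simp only: h ev_closed)
    next
      fix A B assume "A \<in> carrier (amalg_free_product P Q R \<phi>)"
        "B \<in> carrier (amalg_free_product P Q R \<phi>)"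
      then obtain u v where "u \<in> amalg_words P Q" "A = amalg_rel P Q R \<phi> `` {u}"
        "v \<in> amalg_words P Q" "B = amalg_rel P Q R \<phi> `` {v}"
        unfolding amalg_carrier by blast
      then show "h (A \<otimes>\<^bsub>amalg_free_product P Q R \<phi>\<^esub> B) = h A \<otimes>\<^bsub>H\<^esub> h B"
        by (simp only: amalg_mult_class h ev_append append_in_lists_conv)
    qed
  qed (simp add: h Plus_def)
qed

theorem amalg_universal_unique:
  fixes H :: "('c, 'k) monoid_scheme"
  assumes H: "group H"
    and h: "h \<in> hom (amalg_free_product P Q R \<phi>) H" and k: "k \<in> hom (amalg_free_product P Q R \<phi>) H"
    and left: "\<And>x. x \<in> carrier P \<Longrightarrow>
      h (amalg_rel P Q R \<phi> `` {[Inl x]}) = k (amalg_rel P Q R \<phi> `` {[Inl x]})"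
    and right: "\<And>y. y \<in> carrier Q \<Longrightarrow>
      h (amalg_rel P Q R \<phi> `` {[Inr y]}) = k (amalg_rel P Q R \<phi> `` {[Inr y]})"
    and A: "A \<in> carrier (amalg_free_product P Q R \<phi>)"
  shows "h A = k A"
proof -
  interpret h: group_hom "amalg_free_product P Q R \<phi>" H h
    using group_amalg_free_product H h by (simp add: group_hom_def group_hom_axioms_def)
  interpret k: group_hom "amalg_free_product P Q R \<phi>" H k
    using group_amalg_free_product H k by (simp add: group_hom_def group_hom_axioms_def)
  have "h (amalg_rel P Q R \<phi> `` {w}) = k (amalg_rel P Q R \<phi> `` {w})"
    if "w \<in> amalg_words P Q" for w
    using that
  proof (induction w)
    case Nil
    then show ?case using h.hom_one k.hom_one by (simp add: amalg_one)
  next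
    case (Cons x w)
    then have x: "[x] \<in> amalg_words P Q" and w: "w \<in> amalg_words P Q" by auto
    have eq: "amalg_rel P Q R \<phi> `` {x # w}
        = amalg_rel P Q R \<phi> `` {[x]} \<otimes>\<^bsub>amalg_free_product P Q R \<phi>\<^esub> amalg_rel P Q R \<phi> `` {w}"
      using amalg_mult_class[OF x w] by simp
    have "h (amalg_rel P Q R \<phi> `` {[x]}) = k (amalg_rel P Q R \<phi> `` {[x]})"
      using x left right by auto
    with Cons.IH w show ?case
      unfolding eq using x by (simp add: amalg_carrier)
  qed
  with A show ?thesis by (auto simp: amalg_carrier)
qed

end

end

theory Submission
  imports Defs
begin

text \<open>An element conjugate into a factor is handled by retracting the amalgam onto that factor. Up to
  conjugation, any other element is \<open>g = p\<^sub>0 q\<^sub>0 \<dots> p\<^sub>n\<^sub>-\<^sub>1 q\<^sub>n\<^sub>-\<^sub>1\<close> with \<open>p\<^sub>i \<in> P - R\<close> and \<open>q\<^sub>i \<in> Q - S\<close>. Since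
  groups with (VRC) are residually finite, retracts are separable, so there are homomorphisms from \<open>P\<close> and
  \<open>Q\<close> to one finite group \<open>H\<close> that agree on \<open>R\<close>, with common image \<open>D\<close>, and keep all \<open>p\<^sub>i\<close>, \<open>q\<^sub>i\<close> outside
  \<open>D\<close>. Let both groups act on \<open>\<int> \<times> H\<close> by left multiplication on the second component, and conjugate the action
  of \<open>Q\<close> by a permutation that shifts \<open>{i} \<times> D\<close> to \<open>{i - 1} \<times> D\<close> and interchanges the cosets of \<open>D\<close> given
  by \<open>p\<^sub>i\<^sup>-\<^sup>1\<close> and \<open>q\<^sub>i\<close> in \<open>{i} \<times> H\<close>. The two actions still agree on \<open>R\<close>, the resulting action of the amalgam
  commutes with the translation by \<open>n\<close>, and \<open>g\<close> maps \<open>(n, 1)\<close> to \<open>(0, 1)\<close>. The elements that move \<open>(0, 1)\<close> by a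
  multiple of the period form a subgroup of finite index, and the displacement retracts it onto \<open>\<langle>g\<rangle>\<close>.\<close>

section \<open>Finite index and virtual retracts\<close>

context group
begin

lemma inv_cancel_left:
  assumes "x \<in> carrier G" "y \<in> carrier G"
  shows "inv x \<otimes> (x \<otimes> y) = y" "x \<otimes> (inv x \<otimes> y) = y"
  using assms by (simp_all flip: m_assoc)

lemma rcos_eq_imp_diff:
  assumes "subgroup K G" "x \<in> carrier G" "y \<in> carrier G" "K #> x = K #> y"
  shows "x \<otimes> inv y \<in> K"
  using assms subgroup.rcos_module_imp[OF assms(1) is_group assms(3), of x]
    rcos_self[OF assms(2,1)] by auto

text \<open>All index bounds below rest on this: \<open>c\<close> is an invariant with finitely many
  values that separates the right cosets, so sending a value to the coset of some element attaining
  it covers all cosets.\<close>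

lemma finite_rcosetsI:
  assumes "finite (c ` carrier G)"
    and "\<And>x y. x \<in> carrier G \<Longrightarrow> y \<in> carrier G \<Longrightarrow> c x = c y \<Longrightarrow> x \<otimes> inv y \<in> K"
    and "subgroup K G"
  shows "finite (rcosets K)"
proof -
  define d where "d t = K #> (SOME y. y \<in> carrier G \<and> c y = t)" for t
  have "K #> x = d (c x)" if x: "x \<in> carrier G" for x
  proof -
    define y where "y = (SOME y. y \<in> carrier G \<and> c y = c x)"
    have y: "y \<in> carrier G \<and> c y = c x"
      unfolding y_def by (rule someI[of _ x]) (use x in auto)
    then have "x \<otimes> inv y \<in> K" using assms(2) x by simp
    then have "x \<in> K #> y"
      using subgroup.rcos_module_rev[OF assms(3) is_group] x y by blast
    then have "K #> y = K #> x"
      using repr_independence assms(3) y by blast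
    then show ?thesis by (simp add: d_def y_def)
  qed
  then have "rcosets K \<subseteq> d ` c ` carrier G"
    by (auto simp: RCOSETS_def)
  then show ?thesis using assms(1) finite_surj by blast
qed

text \<open>A form of transitivity of finite index. An element \<open>x\<close> is recorded by its
  coset of \<open>K\<close> together with the value of \<open>d\<close> at \<open>x\<close> times
  the inverse of the chosen representative of that coset; the representative cancels when two
  elements with the same record are compared.\<close>

lemma finite_rcosets_trans:
  assumes K: "subgroup K G" "finite (rcosets K)"
    and L: "subgroup L G"
    and d: "finite (d ` K)"
    and *: "\<And>x y. x \<in> K \<Longrightarrow> y \<in> K \<Longrightarrow> d x = d y \<Longrightarrow> x \<otimes> inv y \<in> L"
  shows "finite (rcosets L)"
proof -
  define t where "t C = (SOME y. y \<in> carrier G \<and> K #> y = C)" for C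
  have t: "t (K #> x) \<in> carrier G" "K #> t (K #> x) = K #> x" if "x \<in> carrier G" for x
    using someI[of "\<lambda>y. y \<in> carrier G \<and> K #> y = K #> x" x] that by (auto simp: t_def)
  have xt: "x \<otimes> inv (t (K #> x)) \<in> K" if "x \<in> carrier G" for x
    using that t rcos_eq_imp_diff[OF K(1)] by metis
  show ?thesis
  proof (rule finite_rcosetsI[OF _ _ L])
    let ?c = "\<lambda>x. (K #> x, d (x \<otimes> inv (t (K #> x))))"
    have "?c ` carrier G \<subseteq> (rcosets K) \<times> d ` K"
      using xt rcosetsI subgroup.subset[OF K(1)] by auto
    then show "finite (?c ` carrier G)"
      using K(2) d finite_subset by blast
    fix x y assume x: "x \<in> carrier G" and y: "y \<in> carrier G" and eq: "?c x = ?c y"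
    define s where "s = t (K #> x)"
    have s: "s \<in> carrier G" "t (K #> y) = s"
      using t(1)[OF x] arg_cong[OF eq, of fst] by (simp_all add: s_def)
    have d_eq: "d (x \<otimes> inv s) = d (y \<otimes> inv s)"
      using arg_cong[OF eq, of snd] unfolding s(2) s_def[symmetric] by simp
    have "x \<otimes> inv s \<in> K" "y \<otimes> inv s \<in> K"
      using xt[OF x] xt[OF y] unfolding s(2) by (simp_all only: s_def)
    then have "(x \<otimes> inv s) \<otimes> inv (y \<otimes> inv s) \<in> L"
      using d_eq by (rule *)
    also have "(x \<otimes> inv s) \<otimes> inv (y \<otimes> inv s) = x \<otimes> inv y"
      using x y s by (simp add: inv_mult_group m_assoc inv_cancel_left)
    finally show "x \<otimes> inv y \<in> L" .
  qed
qed

lemma virtual_retractI: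
  assumes H: "subgroup H G" and K: "subgroup K G" "finite (rcosets K)" and "H \<subseteq> K"
    and "\<And>x. x \<in> K \<Longrightarrow> \<rho> x \<in> H"
    and "\<And>x y. x \<in> K \<Longrightarrow> y \<in> K \<Longrightarrow> \<rho> (x \<otimes> y) = \<rho> x \<otimes> \<rho> y"
    and "\<And>h. h \<in> H \<Longrightarrow> \<rho> h = h"
  shows "virtual_retract H G"
  unfolding virtual_retract_def group_retract_def
proof (intro conjI exI)
  show "subgroup H (G\<lparr>carrier := K\<rparr>)"
    using subgroup_incl assms by blast
  show "\<exists>\<rho>\<in>hom (G\<lparr>carrier := K\<rparr>) (G\<lparr>carrier := K, carrier := H\<rparr>). \<forall>h\<in>H. \<rho> h = h"
    using assms(5-7) by (intro bexI[of _ \<rho>]) (auto simp: hom_def)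
qed (use assms in auto)

lemma virtual_retractE:
  assumes "virtual_retract H G"
  obtains K \<rho> where "subgroup H G" "subgroup K G" "finite (rcosets K)" "H \<subseteq> K"
    "\<And>x. x \<in> K \<Longrightarrow> \<rho> x \<in> H"
    "\<And>x y. x \<in> K \<Longrightarrow> y \<in> K \<Longrightarrow> \<rho> (x \<otimes> y) = \<rho> x \<otimes> \<rho> y"
    "\<And>h. h \<in> H \<Longrightarrow> \<rho> h = h"
proof -
  from assms obtain K \<rho> where "subgroup H G" "subgroup K G" "finite (rcosets K)" "H \<subseteq> K"
    and "\<rho> \<in> hom (G\<lparr>carrier := K\<rparr>) (G\<lparr>carrier := K, carrier := H\<rparr>)" "\<forall>h\<in>H. \<rho> h = h"
    unfolding virtual_retract_def group_retract_def by blast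
  then show thesis by (intro that[of K \<rho>]) (auto simp: hom_def)
qed

lemma subgroup_range_int_pow:
  assumes "x \<in> carrier G"
  shows "subgroup (range (\<lambda>n::int. x [^] n)) G"
proof -
  have "range (\<lambda>n::int. x [^] n) = generate G {x}"
    using generate_pow[OF assms] by auto
  then show ?thesis using generate_is_subgroup assms by simp
qed

lemma has_VRC_iff:
  "has_VRC G \<longleftrightarrow> (\<forall>x\<in>carrier G. virtual_retract (range (\<lambda>n::int. x [^] n)) G)"
proof -
  have cyc: "cyclic_group (G\<lparr>carrier := C\<rparr>) \<longleftrightarrow> (\<exists>x\<in>C. C = range (\<lambda>n::int. x [^] n))"
    if C: "subgroup C G" for C
  proof -
    have "x [^]\<^bsub>G\<lparr>carrier := C\<rparr>\<^esub> n = x [^] n" if "x \<in> C" for x and n :: int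
      using int_pow_consistent[OF C that] by simp
    then show ?thesis
      using group.cyclic_group[OF subgroup_imp_group[OF C]] by simp
  qed
  have mem: "x \<in> range (\<lambda>n::int. x [^] n)" if "x \<in> carrier G" for x
    using that by (intro range_eqI[of _ _ 1]) simp
  show ?thesis
    unfolding has_VRC_def
  proof (intro iffI conjI ballI allI impI)
    fix x assume "group G \<and> (\<forall>C. subgroup C G \<longrightarrow> cyclic_group (G\<lparr>carrier := C\<rparr>) \<longrightarrow> virtual_retract C G)"
      and x: "x \<in> carrier G"
    then show "virtual_retract (range (\<lambda>n::int. x [^] n)) G"
      using cyc[OF subgroup_range_int_pow[OF x]] subgroup_range_int_pow[OF x] mem[OF x] by blast
  next
    fix C assume *: "\<forall>x\<in>carrier G. virtual_retract (range (\<lambda>n::int. x [^] n)) G"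
      and C: "subgroup C G" "cyclic_group (G\<lparr>carrier := C\<rparr>)"
    then obtain x where "x \<in> C" "C = range (\<lambda>n::int. x [^] n)" using cyc by blast
    with * show "virtual_retract C G" using subgroup.subset[OF C(1)] by auto
  qed (rule is_group)
qed

section \<open>Normal cores, residual finiteness and separability of retracts\<close>

text \<open>The core, consisting of the elements all of whose conjugates lie in \<open>K\<close>, is
  the kernel of the action by right multiplication on the finite set of cosets of
  \<open>K\<close>.\<close>

lemma ex_normal_core:
  assumes K: "subgroup K G" "finite (rcosets K)"
  obtains N where "N \<lhd> G" "finite (rcosets N)" "N \<subseteq> K"
proof
  define N where "N = {n \<in> carrier G. \<forall>x\<in>carrier G. x \<otimes> n \<otimes> inv x \<in> K}"
  note Ks = subgroup.subset[OF K(1)]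
  have sub: "subgroup N G"
  proof (rule subgroupI)
    show "N \<noteq> {}" using subgroup.one_closed[OF K(1)] by (auto simp: N_def intro!: exI[of _ \<one>])
  next
    fix a assume a: "a \<in> N"
    have "x \<otimes> inv a \<otimes> inv x \<in> K" if x: "x \<in> carrier G" for x
    proof -
      have "inv (x \<otimes> a \<otimes> inv x) \<in> K"
        using a x subgroup.m_inv_closed[OF K(1)] by (auto simp: N_def)
      then show ?thesis using a x by (auto simp: N_def inv_mult_group m_assoc)
    qed
    then show "inv a \<in> N" using a by (auto simp: N_def)
  next
    fix a b assume a: "a \<in> N" and b: "b \<in> N"
    have "x \<otimes> (a \<otimes> b) \<otimes> inv x \<in> K" if x: "x \<in> carrier G" for x
    proof -
      have "(x \<otimes> a \<otimes> inv x) \<otimes> (x \<otimes> b \<otimes> inv x) \<in> K"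
        using a b x subgroup.m_closed[OF K(1)] by (auto simp: N_def)
      moreover have "(x \<otimes> a \<otimes> inv x) \<otimes> (x \<otimes> b \<otimes> inv x) = x \<otimes> (a \<otimes> b) \<otimes> inv x"
        using a b x by (auto simp: N_def m_assoc inv_cancel_left)
      ultimately show ?thesis by simp
    qed
    then show "a \<otimes> b \<in> N" using a b by (auto simp: N_def)
  qed (auto simp: N_def)
  show "N \<lhd> G"
    unfolding normal_inv_iff
  proof (intro conjI sub ballI)
    fix y n assume y: "y \<in> carrier G" and n: "n \<in> N"
    have "x \<otimes> (y \<otimes> n \<otimes> inv y) \<otimes> inv x \<in> K" if x: "x \<in> carrier G" for x
    proof -
      have "(x \<otimes> y) \<otimes> n \<otimes> inv (x \<otimes> y) \<in> K" using n x y by (auto simp: N_def)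
      then show ?thesis using n x y by (auto simp: N_def inv_mult_group m_assoc)
    qed
    then show "y \<otimes> n \<otimes> inv y \<in> N" using n y by (auto simp: N_def)
  qed
  show "N \<subseteq> K"
    by (auto simp: N_def dest: bspec[OF _ one_closed])
  show "finite (rcosets N)"
  proof (rule finite_rcosetsI[OF _ _ sub])
    \<comment> \<open>The invariant is the self-map of the cosets induced by \<open>y\<close>;
      restricting it places it in a finite function space.\<close>
    let ?c = "\<lambda>y. restrict (\<lambda>C. C #> y) (rcosets K)"
    have "C #> y \<in> rcosets K" if C: "C \<in> rcosets K" and y: "y \<in> carrier G" for C y
    proof -
      obtain x where "x \<in> carrier G" "C = K #> x" using C by (auto simp: RCOSETS_def)
      then show ?thesis using y rcosetsI[OF Ks, of "x \<otimes> y"] by (simp add: coset_mult_assoc[OF Ks])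
    qed
    then have "?c ` carrier G \<subseteq> rcosets K \<rightarrow>\<^sub>E rcosets K" by auto
    then show "finite (?c ` carrier G)"
      by (rule finite_subset) (intro finite_PiE K(2))
    fix y z assume y: "y \<in> carrier G" and z: "z \<in> carrier G" and eq: "?c y = ?c z"
    have "x \<otimes> (y \<otimes> inv z) \<otimes> inv x \<in> K" if x: "x \<in> carrier G" for x
    proof -
      have "K #> x #> y = K #> x #> z"
        using fun_cong[OF eq, of "K #> x"] rcosetsI[OF Ks x] by simp
      then have "K #> (x \<otimes> y) = K #> (x \<otimes> z)"
        using x y z by (simp add: coset_mult_assoc[OF Ks])
      then have "(x \<otimes> y) \<otimes> inv (x \<otimes> z) \<in> K"
        using x y z by (intro rcos_eq_imp_diff[OF K(1)]) auto
      then show ?thesis using x y z by (simp add: inv_mult_group m_assoc)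
    qed
    then show "y \<otimes> inv z \<in> N" using y z by (auto simp: N_def)
  qed
qed

lemma finite_rcosets_Int:
  assumes "subgroup K G" "finite (rcosets K)" "subgroup L G" "finite (rcosets L)"
  shows "finite (rcosets (K \<inter> L))"
proof (rule finite_rcosetsI[OF _ _ subgroups_Inter_pair[OF assms(1,3)]])
  let ?c = "\<lambda>x. (K #> x, L #> x)"
  have "?c ` carrier G \<subseteq> (rcosets K) \<times> (rcosets L)"
    using rcosetsI[OF subgroup.subset] assms(1,3) by blast
  then show "finite (?c ` carrier G)" using assms(2,4) finite_subset by blast
qed (use rcos_eq_imp_diff assms(1,3) in auto)

text \<open>Residual finiteness. A finite-index \<open>K\<close> retracts onto the cyclic group of
  \<open>a\<close>, where a subgroup of finite index avoiding \<open>a\<close> is easy to name; its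
  preimage under the retraction does the job.\<close>

lemma has_VRC_imp_separated:
  assumes "has_VRC G" and a: "a \<in> carrier G" "a \<noteq> \<one>"
  obtains K where "subgroup K G" "finite (rcosets K)" "a \<notin> K"
proof -
  have "virtual_retract (range (\<lambda>n::int. a [^] n)) G"
    using assms has_VRC_iff by simp
  then obtain K \<rho> where K: "subgroup K G" "finite (rcosets K)" "range (\<lambda>n::int. a [^] n) \<subseteq> K"
    and \<rho>: "\<And>x. x \<in> K \<Longrightarrow> \<rho> x \<in> range (\<lambda>n::int. a [^] n)"
      "\<And>x y. x \<in> K \<Longrightarrow> y \<in> K \<Longrightarrow> \<rho> (x \<otimes> y) = \<rho> x \<otimes> \<rho> y"
      "\<And>h. h \<in> range (\<lambda>n::int. a [^] n) \<Longrightarrow> \<rho> h = h"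
    by (elim virtual_retractE) blast
  \<comment> \<open>If some nonzero power of \<open>a\<close> is trivial, its absolute exponent
    serves as \<open>m\<close>, since all powers \<open>a [^] (m * k)\<close> are then trivial.
    Otherwise \<open>m = 2\<close> works, because \<open>2 * k - 1\<close> is never zero.\<close>
  obtain m :: int where m: "m > 0" "\<And>k. a \<noteq> a [^] (m * k)"
  proof (cases "\<exists>k::int. k \<noteq> 0 \<and> a [^] k = \<one>")
    case True
    then obtain k :: int where k: "k \<noteq> 0" "a [^] k = \<one>" by blast
    have "a [^] \<bar>k\<bar> = \<one>" using k a by (auto simp: abs_if int_pow_neg)
    then have "a \<noteq> a [^] (\<bar>k\<bar> * j)" for j
      using a int_pow_pow[of a "\<bar>k\<bar>" j] by simp
    with k show ?thesis by (intro that[of "\<bar>k\<bar>"]) auto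
  next
    case False
    have "a \<noteq> a [^] (2 * k)" for k :: int
    proof
      assume "a = a [^] (2 * k)"
      then have "a [^] (2 * k - 1) = \<one>"
        using a by (simp add: int_pow_diff)
      with False show False by (metis diff_eq_eq dvd_triv_left odd_one plus_int_code(2))
    qed
    then show ?thesis by (intro that[of 2]) auto
  qed
  define L where "L = {x \<in> K. \<exists>k. \<rho> x = a [^] (m * k)}"
  have K1: "\<one> \<in> K" and Kinv: "\<And>x. x \<in> K \<Longrightarrow> inv x \<in> K"
    and Kc: "\<And>x. x \<in> K \<Longrightarrow> x \<in> carrier G"
    using K(1) subgroup.one_closed subgroup.m_inv_closed subgroup.mem_carrier by metis+
  have \<rho>1: "\<rho> \<one> = \<one>"
    using \<rho>(3)[of \<one>] by (metis int_pow_0 rangeI)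
  have \<rho>c: "\<rho> x \<in> carrier G" if "x \<in> K" for x using \<rho>(1)[OF that] a by auto
  have \<rho>inv: "\<rho> (inv x) = inv (\<rho> x)" if x: "x \<in> K" for x
  proof -
    have "\<rho> (inv x) \<otimes> \<rho> x = \<one>"
      using \<rho>(2)[of "inv x" x] x Kinv Kc by (simp add: \<rho>1)
    then show ?thesis using inv_equality \<rho>c x Kinv by metis
  qed
  have L: "subgroup L G"
  proof (rule subgroupI)
    show "L \<noteq> {}" using K1 \<rho>1 by (auto simp: L_def intro!: exI[of _ \<one>] exI[of _ 0])
  next
    fix x assume "x \<in> L"
    then obtain k where "x \<in> K" "\<rho> x = a [^] (m * k)" by (auto simp: L_def)
    then have "inv x \<in> K" "\<rho> (inv x) = a [^] (m * (-k))"
      using Kinv \<rho>inv a by (auto simp: int_pow_neg)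
    then show "inv x \<in> L" by (auto simp: L_def simp del: mult_minus_right)
  next
    fix x y assume "x \<in> L" "y \<in> L"
    then obtain k j where "x \<in> K" "\<rho> x = a [^] (m * k)" "y \<in> K" "\<rho> y = a [^] (m * j)"
      by (auto simp: L_def)
    then have "x \<otimes> y \<in> K" "\<rho> (x \<otimes> y) = a [^] (m * (k + j))"
      using \<rho>(2) a subgroup.m_closed[OF K(1)] by (auto simp: int_pow_mult distrib_left)
    then show "x \<otimes> y \<in> L" by (auto simp: L_def)
  qed (use Kc in \<open>auto simp: L_def\<close>)
  \<comment> \<open>The exponent is a mere choice when \<open>a\<close> has finite order; equal
    residues modulo \<open>m\<close> still put the quotient of two elements into
    \<open>L\<close>.\<close>
  define e where "e x = (SOME n::int. \<rho> x = a [^] n)" for x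
  have e: "\<rho> x = a [^] e x" if "x \<in> K" for x
    unfolding e_def by (rule someI_ex) (use \<rho>(1)[OF that] in auto)
  show thesis
  proof (rule that[OF L])
    show "finite (rcosets L)"
    proof (rule finite_rcosets_trans[OF K(1,2) L])
      have "(\<lambda>x. e x mod m) ` K \<subseteq> {0..<m}" using m(1) by auto
      then show "finite ((\<lambda>x. e x mod m) ` K)" using finite_subset by blast
      fix x y assume x: "x \<in> K" and y: "y \<in> K" and eq: "e x mod m = e y mod m"
      then obtain k where k: "e x - e y = m * k" by (metis mod_eq_dvd_iff dvdE)
      have "\<rho> (x \<otimes> inv y) = a [^] (e x - e y)"
        using x y Kinv a by (simp add: \<rho>(2) \<rho>inv e[OF x] e[OF y] int_pow_diff)
      then show "x \<otimes> inv y \<in> L"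
        using x y Kinv subgroup.m_closed[OF K(1)] k by (auto simp: L_def)
    qed
    have "\<rho> a = a" using \<rho>(3)[of a] a by (metis int_pow_1 rangeI)
    then show "a \<notin> L" using m(2) by (auto simp: L_def)
  qed
qed

text \<open>One normal core is taken for each element of \<open>F\<close>, and these finitely many
  cores are intersected.\<close>

lemma has_VRC_imp_separated_finite:
  assumes "has_VRC G" and "finite F" "F \<subseteq> carrier G" "\<one> \<notin> F"
  shows "\<exists>N. N \<lhd> G \<and> finite (rcosets N) \<and> N \<inter> F = {}"
  using assms(2-4)
proof (induction F)
  case empty
  have "finite (rcosets (carrier G))"
    by (rule finite_rcosetsI[where c = "\<lambda>_. ()"]) (auto simp: subgroup_self)
  moreover have "carrier G \<lhd> G"
    by (simp add: normal_inv_iff subgroup_self)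
  ultimately show ?case by auto
next
  case (insert a F)
  then obtain N where N: "N \<lhd> G" "finite (rcosets N)" "N \<inter> F = {}" by auto
  obtain K where K: "subgroup K G" "finite (rcosets K)" "a \<notin> K"
    using has_VRC_imp_separated[OF assms(1), of a] insert.prems by auto
  obtain M where M: "M \<lhd> G" "finite (rcosets M)" "M \<subseteq> K"
    using ex_normal_core[OF K(1,2)] .
  show ?case
    using N M K(3) normal_subgroup_intersect[OF M(1) N(1)]
      finite_rcosets_Int[OF normal_imp_subgroup[OF M(1)] M(2) normal_imp_subgroup[OF N(1)] N(2)]
    by (intro exI[of _ "M \<inter> N"]) auto
qed

text \<open>A retract is the set of fixed points of its retraction, so \<open>p\<close> lies outside
  \<open>R\<close> exactly when \<open>p \<otimes> inv (\<rho> p)\<close> is nontrivial. Residual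
  finiteness applied to these elements separates \<open>p\<close> from all of \<open>R\<close> at
  once.\<close>

lemma has_VRC_imp_retract_separated:
  assumes "has_VRC G" and \<rho>: "\<rho> \<in> hom G G" "\<And>r. r \<in> R \<Longrightarrow> \<rho> r = r" "\<And>x. x \<in> carrier G \<Longrightarrow> \<rho> x \<in> R"
    and F: "finite F" "F \<subseteq> carrier G - R"
  obtains N where "N \<lhd> G" "finite (rcosets N)" "\<And>p r. p \<in> F \<Longrightarrow> r \<in> R \<Longrightarrow> r \<in> carrier G \<Longrightarrow> N #> p \<noteq> N #> r"
proof -
  interpret \<rho>: group_hom G G \<rho> using \<rho>(1) by unfold_locales
  let ?F = "(\<lambda>p. p \<otimes> inv (\<rho> p)) ` F"
  have "p \<otimes> inv (\<rho> p) \<noteq> \<one>" if "p \<in> F" for p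
  proof
    assume "p \<otimes> inv (\<rho> p) = \<one>"
    then have "p = \<rho> p" using that F(2) by (metis DiffD1 \<rho>.hom_closed inv_closed inv_equality inv_inv subsetD)
    then show False using that F(2) \<rho>(3)[of p] by auto
  qed
  then have "\<one> \<notin> ?F" by force
  moreover have Fc: "finite ?F" "?F \<subseteq> carrier G" using F by auto
  ultimately obtain M where M: "M \<lhd> G" "finite (rcosets M)" "M \<inter> ?F = {}"
    using has_VRC_imp_separated_finite[OF assms(1) Fc(1,2)] by blast
  interpret M: normal M G by (rule M(1))
  \<comment> \<open>Adding the preimage condition puts \<open>x \<otimes> inv (\<rho> x)\<close>
    into \<open>M\<close> for \<open>x \<in> N\<close>. At \<open>x = p \<otimes> inv r\<close> this
    element is \<open>p \<otimes> inv (\<rho> p)\<close>, which \<open>M\<close> avoids.\<close>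
  define N where "N = {x \<in> M. \<rho> x \<in> M}"
  have sub: "subgroup N G"
    by (rule subgroupI) (auto simp: N_def intro!: exI[of _ \<one>])
  show thesis
  proof
    show "N \<lhd> G"
      unfolding normal_inv_iff using sub by (auto simp: N_def M.inv_op_closed2)
    show "finite (rcosets N)"
    proof (rule finite_rcosetsI[OF _ _ sub])
      let ?c = "\<lambda>x. (M #> x, M #> \<rho> x)"
      have "?c ` carrier G \<subseteq> (rcosets M) \<times> (rcosets M)" using rcosetsI M.subset by auto
      then show "finite (?c ` carrier G)" using M(2) finite_subset by blast
      fix x y assume x: "x \<in> carrier G" and y: "y \<in> carrier G" and "?c x = ?c y"
      then have "x \<otimes> inv y \<in> M" "\<rho> x \<otimes> inv (\<rho> y) \<in> M"
        using rcos_eq_imp_diff[OF M.subgroup_axioms] by auto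
      then show "x \<otimes> inv y \<in> N" using x y by (simp add: N_def)
    qed
    fix p r assume p: "p \<in> F" and r: "r \<in> R" "r \<in> carrier G"
    have pc: "p \<in> carrier G" using p F by auto
    show "N #> p \<noteq> N #> r"
    proof
      assume "N #> p = N #> r"
      then have *: "p \<otimes> inv r \<in> N" using rcos_eq_imp_diff[OF sub pc r(2)] by simp
      then have "p \<otimes> inv r \<otimes> inv (\<rho> (p \<otimes> inv r)) \<in> M" by (auto simp: N_def)
      also have "p \<otimes> inv r \<otimes> inv (\<rho> (p \<otimes> inv r)) = p \<otimes> inv (\<rho> p)"
        using pc r \<rho>(2)[OF r(1)] by (simp add: inv_mult_group m_assoc inv_cancel_left)
      finally show False using M(3) p by auto
    qed
  qed
qed

end

section \<open>Transport of virtual retracts along homomorphisms\<close>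

text \<open>The finite-index subgroup is pulled back along \<theta>, and the new retraction is
  \<iota> after \<rho> after \<theta>. This serves both for the factors of the amalgam and for
  conjugation.\<close>

lemma virtual_retract_image:
  assumes "group_hom P G \<iota>" and "group_hom G P \<theta>"
    and \<theta>\<iota>: "\<And>x. x \<in> carrier P \<Longrightarrow> \<theta> (\<iota> x) = x"
    and "virtual_retract C P"
  shows "virtual_retract (\<iota> ` C) G"
proof -
  interpret \<iota>: group_hom P G \<iota> by fact
  interpret \<theta>: group_hom G P \<theta> by fact
  from assms(4) obtain K \<rho> where C: "subgroup C P" and K: "subgroup K P" "finite (rcosets\<^bsub>P\<^esub> K)" "C \<subseteq> K"
    and \<rho>: "\<And>x. x \<in> K \<Longrightarrow> \<rho> x \<in> C"
      "\<And>x y. x \<in> K \<Longrightarrow> y \<in> K \<Longrightarrow> \<rho> (x \<otimes>\<^bsub>P\<^esub> y) = \<rho> x \<otimes>\<^bsub>P\<^esub> \<rho> y"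
      "\<And>h. h \<in> C \<Longrightarrow> \<rho> h = h"
    by (elim \<iota>.G.virtual_retractE) blast
  interpret C: subgroup C P by fact
  interpret K: subgroup K P by fact
  let ?K = "{x \<in> carrier G. \<theta> x \<in> K}"
  have subK: "subgroup ?K G"
    by (rule \<iota>.H.subgroupI) (auto intro!: exI[of _ "\<one>\<^bsub>G\<^esub>"])
  show ?thesis
  proof (rule \<iota>.H.virtual_retractI[where K = ?K and \<rho> = "\<lambda>x. \<iota> (\<rho> (\<theta> x))"])
    show "subgroup (\<iota> ` C) G" using \<iota>.subgroup_img_is_subgroup[OF C] .
    show "finite (rcosets\<^bsub>G\<^esub> ?K)"
    proof (rule \<iota>.H.finite_rcosetsI[OF _ _ subK])
      let ?c = "\<lambda>x. K #>\<^bsub>P\<^esub> \<theta> x"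
      have "?c ` carrier G \<subseteq> rcosets\<^bsub>P\<^esub> K" using \<iota>.G.rcosetsI K.subset by auto
      then show "finite (?c ` carrier G)" using K(2) finite_subset by blast
      fix x y assume "x \<in> carrier G" "y \<in> carrier G" "?c x = ?c y"
      then show "x \<otimes>\<^bsub>G\<^esub> inv\<^bsub>G\<^esub> y \<in> ?K"
        using \<iota>.G.rcos_eq_imp_diff[OF K(1), of "\<theta> x" "\<theta> y"] by auto
    qed
  qed (use subK K(3) \<rho> \<theta>\<iota> in \<open>auto simp: \<rho>(2) subset_iff\<close>)
qed

lemma group_hom_image_range_int_pow:
  assumes "group_hom P G \<iota>" "x \<in> carrier P"
  shows "\<iota> ` range (\<lambda>n::int. x [^]\<^bsub>P\<^esub> n) = range (\<lambda>n::int. \<iota> x [^]\<^bsub>G\<^esub> n)"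
  using group_hom.hom_int_pow[OF assms] by (auto simp: image_image)

lemma (in group) virtual_retract_conj:
  assumes x: "x \<in> carrier G" and h: "h \<in> carrier G"
    and "virtual_retract (range (\<lambda>n::int. x [^] n)) G"
  shows "virtual_retract (range (\<lambda>n::int. (h \<otimes> x \<otimes> inv h) [^] n)) G"
proof -
  have conj: "group_hom G G (\<lambda>x. h \<otimes> x \<otimes> inv h)" if h: "h \<in> carrier G" for h
    using h by unfold_locales (auto simp: hom_def m_assoc inv_cancel_left)
  have "virtual_retract ((\<lambda>x. h \<otimes> x \<otimes> inv h) ` range (\<lambda>n::int. x [^] n)) G"
    by (rule virtual_retract_image[OF conj[OF h] conj[OF inv_closed[OF h]] _ assms(3)])
      (use h in \<open>simp add: m_assoc inv_cancel_left\<close>)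
  then show ?thesis
    unfolding group_hom_image_range_int_pow[OF conj[OF h] x] .
qed


section \<open>Actions commuting with a translation\<close>

text \<open>The permutations act on the whole type and merely preserve \<open>X\<close>, so that the
  group operations are plain composition and \<open>id\<close>, with no restriction of
  functions.\<close>

definition equivariant_perms :: "'x set \<Rightarrow> ('x \<Rightarrow> 'x) \<Rightarrow> ('x \<Rightarrow> 'x) monoid" where
  "equivariant_perms X T =
     \<lparr>carrier = {f. bij f \<and> (\<forall>z. f z \<in> X \<longleftrightarrow> z \<in> X) \<and> (\<forall>z. f (T z) = T (f z))},
      monoid.mult = (\<circ>), one = id\<rparr>"

lemma equivariant_perms_simps [simp]:
  "\<one>\<^bsub>equivariant_perms X T\<^esub> = id"
  "f \<otimes>\<^bsub>equivariant_perms X T\<^esub> g = f \<circ> g"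
  "f \<in> carrier (equivariant_perms X T) \<longleftrightarrow>
     bij f \<and> (\<forall>z. f z \<in> X \<longleftrightarrow> z \<in> X) \<and> (\<forall>z. f (T z) = T (f z))"
  by (simp_all add: equivariant_perms_def)

lemma group_equivariant_perms: "group (equivariant_perms X T)"
proof (rule groupI)
  fix f assume "f \<in> carrier (equivariant_perms X T)"
  then have f: "bij f" "\<And>z. f z \<in> X \<longleftrightarrow> z \<in> X" "\<And>z. f (T z) = T (f z)" by auto
  have inv1: "f (inv_into UNIV f z) = z" "inv_into UNIV f (f z) = z" for z
    using f(1) by (simp_all add: bij_is_surj surj_f_inv_f bij_is_inj)
  have "inv_into UNIV f (T z) = T (inv_into UNIV f z)" for z
    using f(3)[of "inv_into UNIV f z"] inv1 by metis
  moreover have "inv_into UNIV f z \<in> X \<longleftrightarrow> z \<in> X" for z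
    using f(2)[of "inv_into UNIV f z"] inv1 by simp
  ultimately show "\<exists>g\<in>carrier (equivariant_perms X T).
      g \<otimes>\<^bsub>equivariant_perms X T\<^esub> f = \<one>\<^bsub>equivariant_perms X T\<^esub>"
    using f(1) by (intro bexI[of _ "inv_into UNIV f"]) (auto simp: bij_imp_bij_inv bij_is_inj)
qed (auto simp: bij_comp comp_assoc)

lemma translation_equivariant:
  fixes f :: "int \<times> 'y \<Rightarrow> int \<times> 'y" and n j :: int
  assumes "\<And>i y. f (i + n, y) = (fst (f (i, y)) + n, snd (f (i, y)))"
  shows "f (i + j * n, y) = (fst (f (i, y)) + j * n, snd (f (i, y)))"
proof (induction j rule: int_induct[where k = 0])
  case (step1 j)
  then show ?case using assms[of "i + j * n" y] by (simp add: algebra_simps)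
next
  case (step2 j)
  have "f (i + j * n, y) = (fst (f (i + (j - 1) * n, y)) + n, snd (f (i + (j - 1) * n, y)))"
    using assms[of "i + (j - 1) * n" y] by (simp add: algebra_simps)
  with step2 show ?case by (auto simp: prod_eq_iff algebra_simps)
qed simp

text \<open>The subgroup \<open>K\<close> of elements that move \<open>(0, y0)\<close> by a multiple of the period acts on the orbit
  of \<open>(0, y0)\<close> under the period translation; this is a homomorphism from \<open>K\<close> to \<open>\<int>\<close> with \<open>g \<mapsto> -1\<close>.\<close>

lemma (in group) virtual_retract_if_translation:
  fixes n :: int and Y :: "'y set"
  assumes n: "n > 0" and Y: "finite Y" "y0 \<in> Y"
    and \<Psi>: "\<Psi> \<in> hom G (equivariant_perms (UNIV \<times> Y) (\<lambda>(i, y). (i + n, y)))"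
    and g: "g \<in> carrier G" "\<Psi> g (n, y0) = (0, y0)"
  shows "virtual_retract (range (\<lambda>k::int. g [^] k)) G"
proof -
  interpret \<Psi>: group_hom G "equivariant_perms (UNIV \<times> Y) (\<lambda>(i, y). (i + n, y))" \<Psi>
    using \<Psi> group_equivariant_perms by (simp add: group_hom_def group_hom_axioms_def)
  have perm: "bij (\<Psi> x)" "\<And>i y. snd (\<Psi> x (i, y)) \<in> Y \<longleftrightarrow> y \<in> Y"
      "\<And>i y. \<Psi> x (i + n, y) = (fst (\<Psi> x (i, y)) + n, snd (\<Psi> x (i, y)))" if "x \<in> carrier G" for x
    using \<Psi>.hom_closed[OF that] by (auto simp: mem_Times_iff case_prod_beta)
  note shift = translation_equivariant[where f = "\<Psi> x" for x, OF perm(3)]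
  have mult: "\<Psi> (x \<otimes> y) z = \<Psi> x (\<Psi> y z)" if "x \<in> carrier G" "y \<in> carrier G" for x y z
    using \<Psi>.hom_mult[OF that] by simp
  have one: "\<Psi> \<one> z = z" for z using \<Psi>.hom_one by simp
  have inv: "\<Psi> (inv x) (\<Psi> x z) = z" "\<Psi> x (\<Psi> (inv x) z) = z" if "x \<in> carrier G" for x z
    using that mult[of "inv x" x z] mult[of x "inv x" z] one[of z] by simp_all
  define K where "K = {x \<in> carrier G. \<exists>j. \<Psi> x (0, y0) = (j * n, y0)}"
  define f where "f x = fst (\<Psi> x (0, y0)) div n" for x
  have f: "\<Psi> x (i * n, y0) = ((f x + i) * n, y0)" if x: "x \<in> K" for x i
  proof -
    obtain j where j: "\<Psi> x (0, y0) = (j * n, y0)" and xc: "x \<in> carrier G"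
      using x by (auto simp: K_def)
    have "\<Psi> x (0 + i * n, y0) = (j * n + i * n, y0)" using shift[OF xc, of 0 i y0] j by simp
    moreover have "f x = j" using j n by (simp add: f_def)
    ultimately show ?thesis by (simp add: algebra_simps)
  qed
  have f_eqI: "f x = j" "x \<in> K" if "x \<in> carrier G" "\<Psi> x (0, y0) = (j * n, y0)" for x j
    using that n by (auto simp: f_def K_def)
  have Kc: "x \<in> carrier G" if "x \<in> K" for x using that by (simp add: K_def)
  have f0: "\<Psi> x (0, y0) = (f x * n, y0)" if "x \<in> K" for x using f[OF that, of 0] by simp
  have f_mult: "f (x \<otimes> y) = f x + f y" "x \<otimes> y \<in> K" if "x \<in> K" "y \<in> K" for x y
    using f_eqI[of "x \<otimes> y" "f x + f y"] that by (simp_all add: mult Kc f0 f)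
  have f_inv: "f (inv x) = - f x" "inv x \<in> K" if x: "x \<in> K" for x
  proof -
    have "\<Psi> x (- f x * n, y0) = (0, y0)" using f[OF x, of "- f x"] by simp
    then have "\<Psi> (inv x) (0, y0) = (- f x * n, y0)" using inv(1)[OF Kc[OF x]] by metis
    then show "f (inv x) = - f x" "inv x \<in> K"
      using f_eqI[OF inv_closed[OF Kc[OF x]]] by blast+
  qed
  have f_one: "f \<one> = 0" "\<one> \<in> K" using f_eqI[of \<one> 0] by (simp_all add: one)
  have subK: "subgroup K G"
    by (rule subgroupI) (use Kc f_mult f_inv f_one in auto)
  \<comment> \<open>Shifting by one period turns the hypothesis on \<open>g\<close> into a statement
    about the base point, giving \<open>f g = - 1\<close>; hence the minus sign in the retraction
    below.\<close>
  have "\<Psi> g (0 + 1 * n, y0) = (0, y0)" using g by simp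
  then have "\<Psi> g (0, y0) = (- 1 * n, y0)" unfolding shift[OF g(1)] by (auto simp: prod_eq_iff)
  note gK = f_eqI[OF g(1) this]
  have pow: "f (g [^] k) = - k \<and> g [^] k \<in> K" for k :: int
  proof (induction k rule: int_induct[where k = 0])
    case (step1 k)
    then show ?case using f_mult[of "g [^] k" g] gK g(1) by (simp add: int_pow_mult)
  next
    case (step2 k)
    then show ?case using f_mult[of "g [^] k" "inv g"] f_inv[OF gK(2)] gK g(1) by (simp add: int_pow_diff)
  qed (simp add: f_one)
  show ?thesis
  proof (rule virtual_retractI[where K = K and \<rho> = "\<lambda>x. g [^] (- f x)"])
    show "finite (rcosets K)"
    proof (rule finite_rcosetsI[OF _ _ subK])
      \<comment> \<open>The inverse appears because the cosets are right cosets: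
        \<open>K #> x\<close> is determined by where \<open>inv x\<close> moves the base point,
        modulo the period. Only finitely many positions remain, since the second component stays in
        \<open>Y\<close>.\<close>
      let ?c = "\<lambda>x. (fst (\<Psi> (inv x) (0, y0)) mod n, snd (\<Psi> (inv x) (0, y0)))"
      have "?c ` carrier G \<subseteq> {0..<n} \<times> Y" using n Y perm(2)[OF inv_closed] by auto
      then show "finite (?c ` carrier G)" using Y(1) finite_subset by blast
      fix x y assume x: "x \<in> carrier G" and y: "y \<in> carrier G" and eq: "?c x = ?c y"
      then obtain j where j: "fst (\<Psi> (inv y) (0, y0)) - fst (\<Psi> (inv x) (0, y0)) = n * j"
        by (metis Pair_inject mod_eq_dvd_iff dvdE)
      then have "\<Psi> (inv y) (0, y0) = (fst (\<Psi> (inv x) (0, y0)) + j * n, snd (\<Psi> (inv x) (0, y0)))"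
        using eq by (auto simp: prod_eq_iff algebra_simps)
      also have "\<Psi> x \<dots> = (j * n, y0)"
        using shift[OF x] inv(2)[OF x] by simp
      finally show "x \<otimes> inv y \<in> K" using f_eqI[of "x \<otimes> inv y" j] x y by (simp add: mult)
    qed
    show "range (\<lambda>k::int. g [^] k) \<subseteq> K" using pow by auto
    show "g [^] (- f x) \<in> range (\<lambda>k::int. g [^] k)" for x by (rule rangeI)
  qed (use subK f_mult f_inv pow g in \<open>auto simp: subgroup_range_int_pow int_pow_mult int_pow_diff int_pow_neg\<close>)
qed


section \<open>Gluing cosets\<close>

text \<open>The cosets are exchanged by right multiplications, so that the exchange commutes with
  left multiplication by \<open>D\<close>.\<close>

definition coset_swap :: "('h, 'k) monoid_scheme \<Rightarrow> 'h set \<Rightarrow> 'h \<Rightarrow> 'h \<Rightarrow> 'h \<Rightarrow> 'h" where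
  "coset_swap H D u v h =
     (if h \<in> D #>\<^bsub>H\<^esub> u then h \<otimes>\<^bsub>H\<^esub> inv\<^bsub>H\<^esub> u \<otimes>\<^bsub>H\<^esub> v
      else if h \<in> D #>\<^bsub>H\<^esub> v then h \<otimes>\<^bsub>H\<^esub> inv\<^bsub>H\<^esub> v \<otimes>\<^bsub>H\<^esub> u
      else h)"

text \<open>In the application \<open>D\<close> is the common image of the amalgamated subgroups,
  \<open>u i\<close> the inverse of the image of the \<open>i\<close>-th letter from
  \<open>P\<close>, and \<open>v i\<close> the image of the \<open>i\<close>-th letter from
  \<open>Q\<close>. The cosets \<open>D\<close>, \<open>D #> u i\<close> and \<open>D #> v i\<close>
  are then pairwise distinct, and periodicity yields commutation with the translation by
  \<open>n\<close>.\<close>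

locale coset_gluing = group H for H (structure) +
  fixes D :: "'a set" and n :: int and u v :: "int \<Rightarrow> 'a"
  assumes D: "subgroup D H"
    and uv: "u i \<in> carrier H" "v i \<in> carrier H" "u i \<notin> D" "v i \<notin> D" "D #> u i \<noteq> D #> v i"
    and periodic: "u (i + n) = u i" "v (i + n) = v i"
begin

sublocale D: subgroup D H by (rule D)

lemma mem_coset_iff:
  assumes "x \<in> carrier H"
  shows "h \<in> D #> x \<longleftrightarrow> h \<in> carrier H \<and> h \<otimes> inv x \<in> D"
  using assms D.rcos_module[OF is_group assms, of h] D.elemrcos_carrier[OF is_group assms] by blast

lemma mult_mem_coset_iff:
  assumes "d \<in> D" "h \<in> carrier H" "x \<in> carrier H"
  shows "d \<otimes> h \<in> D #> x \<longleftrightarrow> h \<in> D #> x"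
proof -
  have "d \<otimes> h \<otimes> inv x = d \<otimes> (h \<otimes> inv x)" using assms by (simp add: m_assoc)
  moreover have "d \<otimes> y \<in> D \<longleftrightarrow> y \<in> D" if "y \<in> carrier H" for y
    using assms(1) that D.m_closed[of "inv d" "d \<otimes> y"] by (auto simp: inv_cancel_left)
  ultimately show ?thesis using assms by (simp add: mem_coset_iff)
qed

lemma coset_disjoint:
  assumes "x \<in> carrier H" "y \<in> carrier H" "D #> x \<noteq> D #> y"
  shows "(D #> x) \<inter> (D #> y) = {}"
  using assms D.subset rcos_disjoint[OF D] rcosetsI[of D] by (auto simp: pairwise_def disjnt_def)

lemma D_coset_disjoint:
  assumes "x \<in> carrier H" "x \<notin> D"
  shows "D \<inter> (D #> x) = {}"
proof -
  have "D #> \<one> \<noteq> D #> x" using assms rcos_self[OF assms(1) D] D.subset by auto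
  then show ?thesis using coset_disjoint[of \<one> x] assms D.subset by simp
qed

abbreviation "swap i \<equiv> coset_swap H D (u i) (v i)"

lemma swap_mem:
  shows "h \<in> D #> u i \<Longrightarrow> swap i h \<in> D #> v i"
    and "h \<in> D #> v i \<Longrightarrow> swap i h \<in> D #> u i"
    and "h \<notin> D #> u i \<Longrightarrow> h \<notin> D #> v i \<Longrightarrow> swap i h = h"
proof -
  note disj = coset_disjoint[OF uv(1,2,5), of i]
  show "swap i h \<in> D #> v i" if "h \<in> D #> u i"
    using that uv[of i] by (auto simp: coset_swap_def mem_coset_iff m_assoc)
  show "swap i h \<in> D #> u i" if h: "h \<in> D #> v i"
  proof -
    have "h \<notin> D #> u i" using disj h by blast
    then have "swap i h = h \<otimes> inv (v i) \<otimes> u i" using h by (simp add: coset_swap_def)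
    then show ?thesis using h uv[of i] by (auto simp: mem_coset_iff m_assoc)
  qed
qed (simp add: coset_swap_def)

lemma swap_swap: "swap i (swap i h) = h"
proof -
  note disj = coset_disjoint[OF uv(1,2,5), of i]
  consider "h \<in> D #> u i" | "h \<in> D #> v i" "h \<notin> D #> u i" | "h \<notin> D #> u i" "h \<notin> D #> v i" by blast
  then show ?thesis
  proof cases
    case 1
    then have "swap i h \<notin> D #> u i" using swap_mem(1) disj by blast
    then show ?thesis
      using 1 swap_mem(1)[OF 1] uv[of i]
      by (auto simp: coset_swap_def mem_coset_iff m_assoc inv_cancel_left)
  next
    case 2
    then show ?thesis
      using swap_mem(2)[OF 2(1)] uv[of i]
      by (auto simp: coset_swap_def mem_coset_iff m_assoc inv_cancel_left)
  qed (simp add: swap_mem(3))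
qed

lemma swap_carrier: "swap i h \<in> carrier H \<longleftrightarrow> h \<in> carrier H"
proof -
  have "swap i h \<in> carrier H" if "h \<in> carrier H" for h
    using that uv[of i] by (auto simp: coset_swap_def)
  from this[of h] this[of "swap i h"] show ?thesis by (auto simp: swap_swap)
qed

lemma swap_D: "swap i h \<in> D \<longleftrightarrow> h \<in> D"
proof -
  have "swap i h = h" if "h \<in> D" for h
    using that D_coset_disjoint[OF uv(1,3), of i] D_coset_disjoint[OF uv(2,4), of i]
    by (intro swap_mem(3)) auto
  from this[of h] this[of "swap i h"] show ?thesis by (auto simp: swap_swap)
qed

lemma swap_mult:
  assumes "d \<in> D" "h \<in> carrier H"
  shows "swap i (d \<otimes> h) = d \<otimes> swap i h"
  using assms uv[of i] by (simp add: coset_swap_def mult_mem_coset_iff m_assoc)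

lemma swap_v: "swap i (v i) = u i"
proof -
  have "v i \<notin> D #> u i" "v i \<in> D #> v i"
    using rcos_self[OF uv(2) D, of i] coset_disjoint[OF uv(1,2,5), of i] by auto
  then show ?thesis using uv[of i] by (simp add: coset_swap_def)
qed

section \<open>The two actions on \<int> \<times> \<open>H\<close>\<close>

text \<open>The parameter takes the values \<open>1\<close> and \<open>- 1\<close>, which give
  mutually inverse permutations because \<open>swap\<close> is an involution preserving
  \<open>D\<close>. Conjugation by \<open>twist 1\<close> is what modifies the action of
  \<open>Q\<close>.\<close>

definition twist :: "int \<Rightarrow> int \<times> 'a \<Rightarrow> int \<times> 'a" where
  "twist s = (\<lambda>(i, h). if h \<in> D then (i + s, h) else (i, swap i h))"

text \<open>Points outside the carrier stay fixed, which makes this a bijection of the whole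
  type.\<close>

definition translate :: "'a \<Rightarrow> int \<times> 'a \<Rightarrow> int \<times> 'a" where
  "translate a = (\<lambda>(i, h). (i, if h \<in> carrier H then a \<otimes> h else h))"

abbreviation perms :: "(int \<times> 'a \<Rightarrow> int \<times> 'a) monoid" where
  "perms \<equiv> equivariant_perms (UNIV \<times> carrier H) (\<lambda>(i, h). (i + n, h))"

lemma twist_twist: "twist s (twist (- s) z) = z"
  by (auto simp: twist_def swap_D swap_swap split: prod.splits)

lemma twist_perms: "twist s \<in> carrier perms"
  unfolding equivariant_perms_simps
proof (intro conjI allI)
  show "bij (twist s)"
    using twist_twist[of s] twist_twist[of "- s"]
    by (intro o_bij[of "twist (- s)"]) (auto simp: fun_eq_iff)
qed (use D.subset in \<open>auto simp: twist_def swap_carrier periodic split: if_splits\<close>)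

lemma translate_mult:
  assumes "a \<in> carrier H" "b \<in> carrier H"
  shows "translate (a \<otimes> b) = translate a \<circ> translate b"
  using assms by (auto simp: translate_def m_assoc fun_eq_iff)

lemma translate_perms:
  assumes "a \<in> carrier H"
  shows "translate a \<in> carrier perms"
  unfolding equivariant_perms_simps
proof (intro conjI allI)
  have "translate a \<circ> translate (inv a) = id" "translate (inv a) \<circ> translate a = id"
    using assms by (simp_all flip: translate_mult) (auto simp: translate_def fun_eq_iff)
  then show "bij (translate a)" using o_bij by blast
qed (use assms in \<open>auto simp: translate_def split: if_splits\<close>)

text \<open>Left multiplication by \<open>D\<close> preserves \<open>D\<close> and commutes with the
  swaps. Conjugation by \<open>twist\<close> therefore leaves the action of \<open>D\<close>
  unchanged, so the actions of both factors agree on \<open>R\<close>.\<close>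

lemma twist_translate:
  assumes "d \<in> D"
  shows "twist s (translate d z) = translate d (twist s z)"
proof -
  obtain i h where z: "z = (i, h)" by force
  have "d \<otimes> h \<in> D \<longleftrightarrow> h \<in> D" if "h \<in> carrier H"
    using mult_mem_coset_iff[OF assms that, of \<one>] D.subset by simp
  then show ?thesis
    using assms D.subset by (auto simp: z twist_def translate_def swap_mult swap_carrier)
qed

lemma hom_left:
  assumes "\<theta> \<in> hom P H"
  shows "(\<lambda>p. translate (\<theta> p)) \<in> hom P perms"
proof (rule homI)
  fix x assume "x \<in> carrier P"
  then show "translate (\<theta> x) \<in> carrier perms"
    using assms by (intro translate_perms) (auto simp: hom_def)
next
  fix x y assume "x \<in> carrier P" "y \<in> carrier P"
  then have "\<theta> (x \<otimes>\<^bsub>P\<^esub> y) = \<theta> x \<otimes> \<theta> y" "\<theta> x \<in> carrier H" "\<theta> y \<in> carrier H"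
    using assms by (auto simp: hom_def)
  then show "translate (\<theta> (x \<otimes>\<^bsub>P\<^esub> y)) = translate (\<theta> x) \<otimes>\<^bsub>perms\<^esub> translate (\<theta> y)"
    by (simp add: translate_mult)
qed

lemma hom_right:
  assumes "\<theta> \<in> hom Q H"
  shows "(\<lambda>q. twist 1 \<circ> translate (\<theta> q) \<circ> twist (- 1)) \<in> hom Q perms"
proof (rule homI)
  interpret perms: group perms by (rule group_equivariant_perms)
  fix x assume "x \<in> carrier Q"
  then have "\<theta> x \<in> carrier H" using assms by (auto simp: hom_def)
  from perms.m_closed[OF perms.m_closed[OF twist_perms[of 1] translate_perms[OF this]] twist_perms[of "- 1"]]
  show "twist 1 \<circ> translate (\<theta> x) \<circ> twist (- 1) \<in> carrier perms"
    by (simp only: equivariant_perms_simps(2))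
next
  fix x y assume "x \<in> carrier Q" "y \<in> carrier Q"
  then have "\<theta> (x \<otimes>\<^bsub>Q\<^esub> y) = \<theta> x \<otimes> \<theta> y" "\<theta> x \<in> carrier H" "\<theta> y \<in> carrier H"
    using assms by (auto simp: hom_def)
  then show "twist 1 \<circ> translate (\<theta> (x \<otimes>\<^bsub>Q\<^esub> y)) \<circ> twist (- 1) =
      (twist 1 \<circ> translate (\<theta> x) \<circ> twist (- 1)) \<otimes>\<^bsub>perms\<^esub> (twist 1 \<circ> translate (\<theta> y) \<circ> twist (- 1))"
    using twist_twist[of "- 1"] by (simp add: translate_mult fun_eq_iff)
qed

text \<open>The point travels through \<open>(i, \<one>)\<close>, \<open>(i, v i)\<close> and
  \<open>(i, u i)\<close> to \<open>(i, \<one>)\<close>: the first move shifts within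
  \<open>D\<close>, and the third is the swap, as \<open>v i\<close> lies outside \<open>D\<close>.
  One pair of letters thus lowers the index by one.\<close>

lemma step:
  "translate (inv (u i)) ((twist 1 \<circ> translate (v i) \<circ> twist (- 1)) (i + 1, \<one>)) = (i, \<one>)"
  using uv[of i] by (simp add: twist_def translate_def swap_v)

end


section \<open>Cyclic words in an amalgam of retracts\<close>

definition alternating :: "('a \<times> 'b) list \<Rightarrow> ('a + 'b) list" where
  "alternating ps = concat (map (\<lambda>(p, q). [Inl p, Inr q]) ps)"

lemma alternating_simps [simp]:
  "alternating [] = []"
  "alternating ((p, q) # ps) = Inl p # Inr q # alternating ps"
  "alternating (ps @ qs) = alternating ps @ alternating qs"
  by (simp_all add: alternating_def)

lemma Inl_in_Plus_iff: "Inl x \<in> A <+> B \<longleftrightarrow> x \<in> A"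
  and Inr_in_Plus_iff: "Inr y \<in> A <+> B \<longleftrightarrow> y \<in> B"
  by auto

text \<open>A word without two adjacent letters from the same factor alternates, and the last four
  cases record which factors its ends belong to. Induction prepends one letter at a time.\<close>

lemma word_alternates_cases:
  obtains (left) u x y v where "w = u @ Inl x # Inl y # v"
    | (right) u x y v where "w = u @ Inr x # Inr y # v"
    | (alt) ps where "w = alternating ps"
    | (alt_left) ps p where "w = alternating ps @ [Inl p]"
    | (right_alt) ps q where "w = Inr q # alternating ps"
    | (right_alt_left) ps p q where "w = Inr q # alternating ps @ [Inl p]"
proof -
  have "(\<exists>u x y v. w = u @ Inl x # Inl y # v) \<or> (\<exists>u x y v. w = u @ Inr x # Inr y # v) \<or>
    (\<exists>ps. w = alternating ps \<or> (\<exists>p. w = alternating ps @ [Inl p]) \<or> (\<exists>q. w = Inr q # alternating ps) \<or>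
      (\<exists>q p. w = Inr q # alternating ps @ [Inl p]))" (is "?A w \<or> ?B w \<or> ?C w")
  proof (induction w)
    case Nil
    then show ?case by (auto intro!: exI[of _ "[]"])
  next
    case (Cons x w)
    consider "?A w" | "?B w" | "?C w" using Cons by blast
    then show ?case
    proof cases
      case 1
      then have "?A (x # w)" by (metis append_Cons)
      then show ?thesis by blast
    next
      case 2
      then have "?B (x # w)" by (metis append_Cons)
      then show ?thesis by blast
    next
      case 3
      then obtain ps where ps: "w = alternating ps \<or> (\<exists>p. w = alternating ps @ [Inl p]) \<or>
          (\<exists>q. w = Inr q # alternating ps) \<or> (\<exists>q p. w = Inr q # alternating ps @ [Inl p])" by blast
      show ?thesis
      proof (cases x)
        case (Inl a)
        consider (starts) b v where "w = Inl b # v" | (Nil) "w = []"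
          | (r) q p where "w = Inr q # alternating ps \<or> w = Inr q # alternating ps @ [Inl p]"
          using ps by (cases ps) force+
        then show ?thesis
        proof cases
          case (starts b v)
          then have "?A (x # w)" using Inl by (intro exI[of _ "[]"]) auto
          then show ?thesis by blast
        next
          case Nil
          then have "x # w = alternating [] @ [Inl a]" using Inl by simp
          then show ?thesis by blast
        next
          case (r q p)
          then have "x # w = alternating ((a, q) # ps) \<or> x # w = alternating ((a, q) # ps) @ [Inl p]"
            using Inl by auto
          then show ?thesis by blast
        qed
      next
        case (Inr a)
        consider (starts) b v where "w = Inr b # v"
          | (l) p where "w = alternating ps \<or> w = alternating ps @ [Inl p]"
          using ps by blast
        then show ?thesis
        proof cases
          case (starts b v)
          then have "?B (x # w)" using Inr by (intro exI[of _ "[]"]) auto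
          then show ?thesis by blast
        next
          case (l p)
          then show ?thesis using Inr by blast
        qed
      qed
    qed
  qed
  then show thesis using that by blast
qed

section \<open>The amalgam and its retractions onto the factors\<close>

locale retract_amalgam = P: group P + Q: group Q
  for P :: "('a, 'm) monoid_scheme" and Q :: "('b, 'n) monoid_scheme" +
  fixes R :: "'a set" and \<phi> :: "'a \<Rightarrow> 'b" and to_Q :: "'a \<Rightarrow> 'b" and to_P :: "'b \<Rightarrow> 'a"
  assumes R: "R \<subseteq> carrier P"
    and to_Q: "to_Q \<in> hom P Q" "\<And>r. r \<in> R \<Longrightarrow> to_Q r = \<phi> r" "\<And>p. p \<in> carrier P \<Longrightarrow> to_Q p \<in> \<phi> ` R"
    and to_P: "to_P \<in> hom Q P" "\<And>r. r \<in> R \<Longrightarrow> to_P (\<phi> r) = r" "\<And>q. q \<in> carrier Q \<Longrightarrow> to_P q \<in> R"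
    and VRC: "has_VRC P" "has_VRC Q"
begin

sublocale to_Q: group_hom P Q to_Q using to_Q(1) by unfold_locales
sublocale to_P: group_hom Q P to_P using to_P(1) by unfold_locales

lemma \<phi>: "\<phi> \<in> R \<rightarrow> carrier Q"
  using R to_Q.hom_closed to_Q(2) by (metis Pi_I subsetD)

lemmas amalgam_facts = P.is_group Q.is_group R \<phi>

abbreviation G :: "('a + 'b) list set monoid" where
  "G \<equiv> amalg_free_product P Q R \<phi>"

abbreviation cls :: "('a + 'b) list \<Rightarrow> ('a + 'b) list set" where
  "cls w \<equiv> amalg_rel P Q R \<phi> `` {w}"

sublocale G: group G
  by (rule group_amalg_free_product[OF amalgam_facts])

lemmas amalg = equiv_amalg_rel[OF amalgam_facts] amalg_mult_class[OF amalgam_facts]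
  amalg_carrier[OF amalgam_facts]

lemma cls_closed [simp]: "w \<in> amalg_words P Q \<Longrightarrow> cls w \<in> carrier G"
  by (simp add: amalg(3))

lemma cls_append:
  "u \<in> amalg_words P Q \<Longrightarrow> v \<in> amalg_words P Q \<Longrightarrow> cls (u @ v) = cls u \<otimes>\<^bsub>G\<^esub> cls v"
  by (simp add: amalg(2))

lemma cls_replace:
  assumes "(u, u') \<in> amalg_rel P Q R \<phi>" "v \<in> amalg_words P Q"
  shows "cls (u @ v) = cls (u' @ v)"
  by (rule equiv_class_eq[OF amalg(1) amalg_rel.append[OF assms(1) amalg_rel.refl[OF assms(2)]]])

abbreviation generates_virtual_retract :: "('a + 'b) list \<Rightarrow> bool" where
  "generates_virtual_retract w \<equiv> virtual_retract (range (\<lambda>k::int. cls w [^]\<^bsub>G\<^esub> k)) G"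

text \<open>Rotating a word cyclically conjugates its class by \<open>cls u\<close>.\<close>

lemma generates_virtual_retract_rotate:
  assumes u: "u \<in> amalg_words P Q" and v: "v \<in> amalg_words P Q"
    and vr: "generates_virtual_retract (v @ u)"
  shows "generates_virtual_retract (u @ v)"
proof -
  have "cls (u @ v) = cls u \<otimes>\<^bsub>G\<^esub> cls (v @ u) \<otimes>\<^bsub>G\<^esub> inv\<^bsub>G\<^esub> cls u"
    using u v by (simp add: cls_append G.m_assoc)
  then show ?thesis
    using G.virtual_retract_conj[OF _ _ vr, of "cls u"] u v by simp
qed

text \<open>The identity of \<open>P\<close> and \<open>to_P\<close> agree on the amalgamated
  subgroup, so together they define a retraction of the amalgam onto \<open>P\<close>, along which
  (VRC) of \<open>P\<close> is transported.\<close>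

lemma generates_virtual_retract_left:
  assumes "p \<in> carrier P"
  shows "generates_virtual_retract [Inl p]"
proof -
  let ?\<iota> = "\<lambda>p. cls [Inl p]"
  have \<iota>: "group_hom P G ?\<iota>"
    by unfold_locales (rule hom_amalg_left[OF amalgam_facts])
  have "(\<lambda>x. x) \<in> hom P P" by (simp add: hom_def)
  from amalg_universal_exists[OF amalgam_facts P.is_group this to_P(1)] to_P(2)
  obtain \<theta> where \<theta>: "\<theta> \<in> hom G P" "\<And>x. x \<in> carrier P \<Longrightarrow> \<theta> (?\<iota> x) = x" by auto
  have "group_hom G P \<theta>" using \<theta>(1) by unfold_locales
  from virtual_retract_image[OF \<iota> this \<theta>(2)]
  show ?thesis
    using VRC(1) assms P.has_VRC_iff group_hom_image_range_int_pow[OF \<iota> assms] by metis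
qed

lemma generates_virtual_retract_right:
  assumes "q \<in> carrier Q"
  shows "generates_virtual_retract [Inr q]"
proof -
  let ?\<iota> = "\<lambda>q. cls [Inr q]"
  have \<iota>: "group_hom Q G ?\<iota>"
    by unfold_locales (rule hom_amalg_right[OF amalgam_facts])
  have "(\<lambda>x. x) \<in> hom Q Q" by (simp add: hom_def)
  from amalg_universal_exists[OF amalgam_facts Q.is_group to_Q(1) this] to_Q(2)
  obtain \<theta> where \<theta>: "\<theta> \<in> hom G Q" "\<And>x. x \<in> carrier Q \<Longrightarrow> \<theta> (?\<iota> x) = x" by auto
  have "group_hom G Q \<theta>" using \<theta>(1) by unfold_locales
  from virtual_retract_image[OF \<iota> this \<theta>(2)]
  show ?thesis
    using VRC(2) assms Q.has_VRC_iff group_hom_image_range_int_pow[OF \<iota> assms] by metis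
qed

lemma R_image: "to_P ` carrier Q = R"
proof
  show "R \<subseteq> to_P ` carrier Q"
  proof
    fix r assume "r \<in> R"
    then show "r \<in> to_P ` carrier Q"
      using to_P(2) \<phi> by (intro image_eqI[of r to_P "\<phi> r"]) auto
  qed
qed (use to_P(3) in blast)

text \<open>The case that needs the action: no letter lies in the amalgamated subgroup, so every
  pair of letters can be made to move the base point by one step.\<close>

lemma generates_virtual_retract_alternating:
  assumes ps: "ps \<noteq> []" "fst ` set ps \<subseteq> carrier P - R" "snd ` set ps \<subseteq> carrier Q - \<phi> ` R"
  shows "generates_virtual_retract (alternating ps)"
proof -
  \<comment> \<open>This composite is a retraction of \<open>P\<close> onto \<open>R\<close>, so the
    letters from \<open>P\<close> can be separated from \<open>R\<close> in a finite quotient. The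
    same is then done for \<open>Q\<close>.\<close>
  have "to_P \<circ> to_Q \<in> hom P P" by (rule hom_compose[OF to_Q(1) to_P(1)])
  moreover have "(to_P \<circ> to_Q) r = r" if "r \<in> R" for r
    using that by (simp add: to_P(2) to_Q(2))
  moreover have "(to_P \<circ> to_Q) p \<in> R" if "p \<in> carrier P" for p
    using to_P(3)[OF to_Q.hom_closed[OF that]] by simp
  moreover have "finite (fst ` set ps)" by simp
  ultimately obtain N where N: "N \<lhd> P" "finite (rcosets\<^bsub>P\<^esub> N)"
      "\<And>p r. p \<in> fst ` set ps \<Longrightarrow> r \<in> R \<Longrightarrow> r \<in> carrier P \<Longrightarrow> N #>\<^bsub>P\<^esub> p \<noteq> N #>\<^bsub>P\<^esub> r"
    using ps(2) by (rule P.has_VRC_imp_retract_separated[OF VRC(1)]) blast+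
  have "to_Q \<circ> to_P \<in> hom Q Q" by (rule hom_compose[OF to_P(1) to_Q(1)])
  moreover have "(to_Q \<circ> to_P) s = s" if "s \<in> \<phi> ` R" for s
    using that by (auto simp: to_P(2) to_Q(2))
  moreover have "(to_Q \<circ> to_P) q \<in> \<phi> ` R" if "q \<in> carrier Q" for q
    using to_Q(3)[OF to_P.hom_closed[OF that]] by simp
  moreover have "finite (snd ` set ps)" by simp
  ultimately obtain M where M: "M \<lhd> Q" "finite (rcosets\<^bsub>Q\<^esub> M)"
      "\<And>q s. q \<in> snd ` set ps \<Longrightarrow> s \<in> \<phi> ` R \<Longrightarrow> s \<in> carrier Q \<Longrightarrow> M #>\<^bsub>Q\<^esub> q \<noteq> M #>\<^bsub>Q\<^esub> s"
    using ps(3) by (rule Q.has_VRC_imp_retract_separated[OF VRC(2)]) blast+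
  interpret N: normal N P by (rule N(1))
  interpret M: normal M Q by (rule M(1))
  interpret PN: group "P Mod N" by (rule N.factorgroup_is_group)
  interpret QM: group "Q Mod M" by (rule M.factorgroup_is_group)
  interpret modN: group_hom P "P Mod N" "\<lambda>p. N #>\<^bsub>P\<^esub> p"
    using N.r_coset_hom_Mod by unfold_locales
  interpret modM: group_hom Q "Q Mod M" "\<lambda>q. M #>\<^bsub>Q\<^esub> q"
    using M.r_coset_hom_Mod by unfold_locales
  define H where "H = (P Mod N) \<times>\<times> (Q Mod M)"
  interpret H: group H unfolding H_def by (rule DirProd_group[OF PN.is_group QM.is_group])
  \<comment> \<open>Each factor maps to its own finite quotient and, through \<open>to_Q\<close> or
    \<open>to_P\<close>, to that of the other. This forces agreement on \<open>R\<close>; the first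
    component controls the letters from \<open>P\<close>, the second those from
    \<open>Q\<close>.\<close>
  define \<theta> where "\<theta> p = (N #>\<^bsub>P\<^esub> p, M #>\<^bsub>Q\<^esub> to_Q p)" for p
  define \<theta>' where "\<theta>' q = (N #>\<^bsub>P\<^esub> to_P q, M #>\<^bsub>Q\<^esub> q)" for q
  interpret \<theta>: group_hom P H \<theta>
    by unfold_locales (auto simp: hom_def H_def \<theta>_def)
  interpret \<theta>': group_hom Q H \<theta>'
    by unfold_locales (auto simp: hom_def H_def \<theta>'_def)
  have \<theta>\<phi>: "\<theta>' (\<phi> r) = \<theta> r" if "r \<in> R" for r
    using that by (simp add: \<theta>_def \<theta>'_def to_P(2) to_Q(2))
  define D where "D = \<theta> ` R"
  have D: "subgroup D H"
    unfolding D_def R_image[symmetric]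
    by (rule \<theta>.subgroup_img_is_subgroup[OF to_P.img_is_subgroup])
  define n where "n = int (length ps)"
  \<comment> \<open>The word is read cyclically, so that every integer indexes a pair.\<close>
  define pq where "pq i = ps ! nat (i mod n)" for i
  have n: "n > 0" using ps(1) by (simp add: n_def)
  have pq: "pq i \<in> set ps" for i
    using n by (auto simp: pq_def n_def nat_less_iff)
  have pq_periodic: "pq (i + n) = pq i" for i by (simp add: pq_def)
  define p q where "p i = fst (pq i)" and "q i = snd (pq i)" for i
  have p: "p i \<in> fst ` set ps" "p i \<in> carrier P" and q: "q i \<in> snd ` set ps" "q i \<in> carrier Q" for i
    using pq[of i] ps(2,3) by (auto simp: p_def q_def)
  have p_D: "\<theta> (p i) \<notin> D" for i
    using N(3)[OF p(1)] R by (auto simp: D_def \<theta>_def)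
  have q_D: "\<theta>' (q i) \<notin> D" for i
    using M(3)[OF q(1)] R to_Q(3) by (auto simp: D_def \<theta>_def \<theta>'_def)
  interpret coset_gluing H D n "\<lambda>i. inv\<^bsub>H\<^esub> \<theta> (p i)" "\<lambda>i. \<theta>' (q i)"
  proof (intro coset_gluing.intro coset_gluing_axioms.intro H.is_group D q_D)
    fix i
    show "inv\<^bsub>H\<^esub> \<theta> (p i) \<in> carrier H" "\<theta>' (q i) \<in> carrier H" using p q by auto
    show "inv\<^bsub>H\<^esub> \<theta> (p i) \<notin> D"
      using p_D[of i] subgroup.m_inv_closed[OF D, of "inv\<^bsub>H\<^esub> \<theta> (p i)"] p(2)[of i] by auto
    \<comment> \<open>Equality would make the images of \<open>p i\<close>, some
      \<open>r \<in> R\<close> and \<open>q i\<close> multiply to one. In the first component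
      \<open>q i\<close> acts as \<open>to_P (q i) \<in> R\<close>, so \<open>p i\<close> would
      share a coset of \<open>N\<close> with an element of \<open>R\<close>.\<close>
    show "D #>\<^bsub>H\<^esub> inv\<^bsub>H\<^esub> \<theta> (p i) \<noteq> D #>\<^bsub>H\<^esub> \<theta>' (q i)"
    proof
      assume "D #>\<^bsub>H\<^esub> inv\<^bsub>H\<^esub> \<theta> (p i) = D #>\<^bsub>H\<^esub> \<theta>' (q i)"
      then have "inv\<^bsub>H\<^esub> \<theta> (p i) \<otimes>\<^bsub>H\<^esub> inv\<^bsub>H\<^esub> \<theta>' (q i) \<in> D"
        using H.rcos_eq_imp_diff[OF D] p q by simp
      then obtain r where r: "r \<in> R" "\<theta> r = inv\<^bsub>H\<^esub> \<theta> (p i) \<otimes>\<^bsub>H\<^esub> inv\<^bsub>H\<^esub> \<theta>' (q i)"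
        by (auto simp: D_def)
      define s where "s = r \<otimes>\<^bsub>P\<^esub> to_P (q i)"
      have s: "s \<in> carrier P" using r R q(2) by (auto simp: s_def)
      have "\<theta> (p i) \<otimes>\<^bsub>H\<^esub> (\<theta> r \<otimes>\<^bsub>H\<^esub> \<theta>' (q i)) = \<one>\<^bsub>H\<^esub>"
        unfolding r(2) using p q by (simp add: H.m_assoc del: \<theta>.hom_inv \<theta>'.hom_inv)
      then have "fst (\<theta> (p i) \<otimes>\<^bsub>H\<^esub> (\<theta> r \<otimes>\<^bsub>H\<^esub> \<theta>' (q i))) = \<one>\<^bsub>P Mod N\<^esub>"
        by (simp add: H_def)
      then have one: "N #>\<^bsub>P\<^esub> (p i \<otimes>\<^bsub>P\<^esub> s) = \<one>\<^bsub>P Mod N\<^esub>"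
        using p q r R by (auto simp: H_def \<theta>_def \<theta>'_def s_def subset_iff)
      have "N #>\<^bsub>P\<^esub> p i = N #>\<^bsub>P\<^esub> ((p i \<otimes>\<^bsub>P\<^esub> s) \<otimes>\<^bsub>P\<^esub> inv\<^bsub>P\<^esub> s)"
        using p s by (simp add: P.m_assoc)
      also have "\<dots> = (N #>\<^bsub>P\<^esub> (p i \<otimes>\<^bsub>P\<^esub> s)) \<otimes>\<^bsub>P Mod N\<^esub> (N #>\<^bsub>P\<^esub> inv\<^bsub>P\<^esub> s)"
        using p s by (intro modN.hom_mult) auto
      also have "\<dots> = N #>\<^bsub>P\<^esub> inv\<^bsub>P\<^esub> s"
        unfolding one using s by (intro PN.l_one modN.hom_closed) auto
      finally have "N #>\<^bsub>P\<^esub> p i = N #>\<^bsub>P\<^esub> inv\<^bsub>P\<^esub> s" .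
      moreover have "subgroup R P"
        using to_P.img_is_subgroup R_image by simp
      then have "inv\<^bsub>P\<^esub> s \<in> R"
        using r(1) to_P(3)[OF q(2)] by (simp add: s_def subgroup.m_closed subgroup.m_inv_closed)
      ultimately show False using N(3)[OF p(1), of "inv\<^bsub>P\<^esub> s"] s by blast
    qed
  qed (simp_all only: p_def q_def pq_periodic)
  let ?\<alpha> = "\<lambda>x. translate (\<theta> x)" and ?\<beta> = "\<lambda>y. twist 1 \<circ> translate (\<theta>' y) \<circ> twist (- 1)"
  have "?\<alpha> r = ?\<beta> (\<phi> r)" if "r \<in> R" for r
    using that twist_translate[of "\<theta> r" 1] twist_twist[of 1] by (simp add: \<theta>\<phi> D_def fun_eq_iff)
  from amalg_universal_exists[OF amalgam_facts group_equivariant_perms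
      hom_left[OF \<theta>.homh] hom_right[OF \<theta>'.homh] this]
  obtain \<Psi> where \<Psi>: "\<Psi> \<in> hom G perms"
    and \<Psi>_left: "\<And>x. x \<in> carrier P \<Longrightarrow> \<Psi> (cls [Inl x]) = ?\<alpha> x"
    and \<Psi>_right: "\<And>y. y \<in> carrier Q \<Longrightarrow> \<Psi> (cls [Inr y]) = ?\<beta> y" by blast
  have \<Psi>_mult: "\<Psi> (x \<otimes>\<^bsub>G\<^esub> y) = \<Psi> x \<circ> \<Psi> y" if "x \<in> carrier G" "y \<in> carrier G" for x y
    using hom_mult[OF \<Psi> that] by simp
  have \<Psi>_one: "\<Psi> (cls []) = id"
    using hom_one[OF \<Psi> G.is_group group_equivariant_perms] by (simp add: amalg_one[OF amalgam_facts])
  \<comment> \<open>The start \<open>k\<close> varies because removing the first pair leaves a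
    segment that starts at \<open>k + 1\<close>. The whole word is the case
    \<open>k = 0\<close>.\<close>
  have path: "\<Psi> (cls (alternating qs)) (k + int (length qs), \<one>\<^bsub>H\<^esub>) = (k, \<one>\<^bsub>H\<^esub>) \<and> alternating qs \<in> amalg_words P Q"
    if "\<And>j. j < length qs \<Longrightarrow> qs ! j = pq (k + int j)" for qs k
    using that
  proof (induction qs arbitrary: k)
    case (Cons x qs)
    have x: "x = (p k, q k)" using Cons.prems[of 0] by (simp add: p_def q_def)
    have IH: "\<Psi> (cls (alternating qs)) (k + 1 + int (length qs), \<one>\<^bsub>H\<^esub>) = (k + 1, \<one>\<^bsub>H\<^esub>)"
      "alternating qs \<in> amalg_words P Q"
      using Cons.IH[of "k + 1"] Cons.prems[of "Suc j" for j] by (auto simp: ac_simps)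
    have words: "[Inl (p k)] \<in> amalg_words P Q" "[Inr (q k)] \<in> amalg_words P Q"
      using p q by auto
    have "cls (alternating (x # qs)) = cls [Inl (p k)] \<otimes>\<^bsub>G\<^esub> (cls [Inr (q k)] \<otimes>\<^bsub>G\<^esub> cls (alternating qs))"
      using words IH(2) by (simp add: x flip: cls_append)
    then have "\<Psi> (cls (alternating (x # qs))) (k + int (length (x # qs)), \<one>\<^bsub>H\<^esub>)
        = ?\<alpha> (p k) (?\<beta> (q k) (k + 1, \<one>\<^bsub>H\<^esub>))"
      using words IH p q by (simp add: \<Psi>_mult \<Psi>_left \<Psi>_right ac_simps)
    also have "\<dots> = (k, \<one>\<^bsub>H\<^esub>)"
      using step[of k] p(2)[of k] by simp
    finally show ?case using words IH(2) by (simp add: x)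
  qed (simp add: \<Psi>_one)
  have "\<Psi> (cls (alternating ps)) (n, \<one>\<^bsub>H\<^esub>) = (0, \<one>\<^bsub>H\<^esub>)" "alternating ps \<in> amalg_words P Q"
    using path[of ps 0] by (auto simp: pq_def n_def)
  moreover have "finite (carrier H)"
    using N(2) M(2) by (simp add: H_def FactGroup_def)
  ultimately show ?thesis
    using G.virtual_retract_if_translation[OF n _ H.one_closed \<Psi>] by simp
qed

section \<open>Reduction of arbitrary words\<close>

text \<open>By induction on the length: a word in which two letters can be merged after a rotation
  reduces to a shorter one. What remains, up to rotation, is a single letter, the empty word, or an
  alternating word with no letter in the amalgamated subgroup.\<close>

lemma generates_virtual_retract:
  "w \<in> amalg_words P Q \<Longrightarrow> generates_virtual_retract w"
proof (induction w rule: length_induct)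
  case (1 w)
  note shorter = 1(1)[rule_format]
  note [simp] = Inl_in_Plus_iff Inr_in_Plus_iff
  \<comment> \<open>Here and below, the claims cover all words as long as \<open>w\<close>, and
    hence its rotations.\<close>
  have left_left: "generates_virtual_retract (Inl x # Inl y # v)"
    if "length (Inl x # Inl y # v) = length w" "Inl x # Inl y # v \<in> amalg_words P Q" for x y v
    using that shorter[of "Inl (x \<otimes>\<^bsub>P\<^esub> y) # v"]
      cls_replace[OF amalg_rel.mult_left[where x = x and y = y and P = P and Q = Q and R = R and \<phi> = \<phi>], of v] by auto
  have right_right: "generates_virtual_retract (Inr x # Inr y # v)"
    if "length (Inr x # Inr y # v) = length w" "Inr x # Inr y # v \<in> amalg_words P Q" for x y v
    using that shorter[of "Inr (x \<otimes>\<^bsub>Q\<^esub> y) # v"]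
      cls_replace[OF amalg_rel.mult_right[where x = x and y = y and P = P and Q = Q and R = R and \<phi> = \<phi>], of v] by auto
  have flip: "cls (Inl r # v) = cls (Inr (\<phi> r) # v)" if "r \<in> R" "v \<in> amalg_words P Q" for r v
    using cls_replace[OF amalg_rel.amalg[OF that(1)] that(2)] by simp
  \<comment> \<open>A letter from \<open>R\<close> can be read in either factor, so it merges with
    the next letter, which exists as \<open>v\<close> is nonempty.\<close>
  have left_R: "generates_virtual_retract (Inl r # v)"
    if "length (Inl r # v) = length w" "r \<in> R" "v \<in> amalg_words P Q" "v \<noteq> []" for r v
  proof (cases v)
    case (Cons x v')
    have r: "r \<in> carrier P" "\<phi> r \<in> carrier Q" using that(2) R \<phi> by auto
    show ?thesis
    proof (cases x)
      case (Inl y)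
      then show ?thesis using that Cons r left_left[of r y v'] by simp
    next
      case (Inr y)
      then show ?thesis using that Cons r right_right[of "\<phi> r" y v'] flip[OF that(2,3)] by simp
    qed
  qed (use that in simp)
  have right_R: "generates_virtual_retract (Inr s # v)"
    if "length (Inr s # v) = length w" "s \<in> \<phi> ` R" "v \<in> amalg_words P Q" "v \<noteq> []" for s v
    using that left_R[of _ v] flip[of _ v] by auto
  have alternating: "generates_virtual_retract (alternating ps)"
    if len: "length (alternating ps) = length w" and word: "alternating ps \<in> amalg_words P Q" for ps
  proof (cases "ps = []")
    case True
    then show ?thesis
      using generates_virtual_retract_left[OF P.one_closed]
        cls_replace[OF amalg_rel.one_left, of "[]"] by simp
  next
    case False
    have in_carrier: "x \<in> carrier P \<and> y \<in> carrier Q" if xy: "(x, y) \<in> set ps" for x y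
    proof -
      obtain ps1 ps2 where "ps = ps1 @ (x, y) # ps2" using split_list[OF xy] by blast
      then show ?thesis using word by simp
    qed
    consider "\<And>x y. (x, y) \<in> set ps \<Longrightarrow> x \<notin> R \<and> y \<notin> \<phi> ` R"
      | x y where "(x, y) \<in> set ps" "x \<in> R" | x y where "(x, y) \<in> set ps" "y \<in> \<phi> ` R"
      by blast
    then show ?thesis
    proof cases
      case 1
      then have "fst ` set ps \<subseteq> carrier P - R" "snd ` set ps \<subseteq> carrier Q - \<phi> ` R"
        using in_carrier by (simp_all add: image_subset_iff split_paired_all)
      then show ?thesis
        by (rule generates_virtual_retract_alternating[OF False])
    next
      case (2 x y)
      then obtain ps1 ps2 where "ps = ps1 @ (x, y) # ps2" by (blast dest: split_list)
      then show ?thesis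
        using generates_virtual_retract_rotate[of "alternating ps1" "Inl x # Inr y # alternating ps2"]
          left_R[of x "Inr y # alternating ps2 @ alternating ps1"] 2 len word by auto
    next
      case (3 x y)
      then obtain ps1 ps2 where "ps = ps1 @ (x, y) # ps2" by (blast dest: split_list)
      then show ?thesis
        using generates_virtual_retract_rotate[of "alternating ps1 @ [Inl x]" "Inr y # alternating ps2"]
          right_R[of y "alternating ps2 @ alternating ps1 @ [Inl x]"] 3 len word by auto
    qed
  qed
  show ?case
  proof (cases w rule: word_alternates_cases)
    case (left u x y v)
    then show ?thesis
      using generates_virtual_retract_rotate[of u "Inl x # Inl y # v"] left_left[of x y "v @ u"] 1(2)
      by auto
  next
    case (right u x y v)
    then show ?thesis
      using generates_virtual_retract_rotate[of u "Inr x # Inr y # v"] right_right[of x y "v @ u"] 1(2)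
      by auto
  next
    case (alt ps)
    then show ?thesis using alternating[of ps] 1(2) by simp
  next
    case (alt_left ps p)
    show ?thesis
    proof (cases ps)
      case Nil
      then show ?thesis using alt_left 1(2) generates_virtual_retract_left by auto
    next
      case (Cons xy ps')
      then show ?thesis
        using generates_virtual_retract_rotate[of "alternating ps" "[Inl p]"]
          left_left[of p "fst xy" "Inr (snd xy) # alternating ps'"] alt_left 1(2)
        by (cases xy) auto
    qed
  next
    case (right_alt ps q)
    show ?thesis
    proof (cases ps rule: rev_cases)
      case Nil
      then show ?thesis using right_alt 1(2) generates_virtual_retract_right by auto
    next
      case (snoc ps' xy)
      then show ?thesis
        using generates_virtual_retract_rotate[of "Inr q # alternating ps' @ [Inl (fst xy)]" "[Inr (snd xy)]"]
          right_right[of "snd xy" q "alternating ps' @ [Inl (fst xy)]"] right_alt 1(2)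
        by (cases xy) auto
    qed
  next
    \<comment> \<open>Moving the last letter to the front gives an alternating word of the same
      length, so nothing needs to be merged here.\<close>
    case (right_alt_left ps p q)
    then show ?thesis
      using generates_virtual_retract_rotate[of "Inr q # alternating ps" "[Inl p]"]
        alternating[of "(p, q) # ps"] 1(2) by auto
  qed
qed

lemma has_VRC_amalgam: "has_VRC G"
  unfolding G.has_VRC_iff
proof
  fix x assume "x \<in> carrier G"
  then obtain w where "w \<in> amalg_words P Q" "x = cls w" unfolding amalg(3) by blast
  then show "virtual_retract (range (\<lambda>k::int. x [^]\<^bsub>G\<^esub> k)) G"
    using generates_virtual_retract by simp
qed

end

theorem theorem6p3:
  fixes P :: "('a, 'm) monoid_scheme" and Q :: "('b, 'n) monoid_scheme"
    and R :: "'a set" and S :: "'b set" and \<phi> :: "'a \<Rightarrow> 'b"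
  assumes "group P" and "group Q"
    and "group_retract R P" and "group_retract S Q"
    and "\<phi> \<in> iso (P\<lparr>carrier := R\<rparr>) (Q\<lparr>carrier := S\<rparr>)"
    and "has_VRC P" and "has_VRC Q"
  shows "has_VRC (amalg_free_product P Q R \<phi>)"
proof -
  from assms(3) obtain \<rho> where R: "subgroup R P"
    and \<rho>: "\<rho> \<in> hom P (P\<lparr>carrier := R\<rparr>)" "\<And>r. r \<in> R \<Longrightarrow> \<rho> r = r"
    unfolding group_retract_def by blast
  from assms(4) obtain \<eta> where S: "subgroup S Q"
    and \<eta>: "\<eta> \<in> hom Q (Q\<lparr>carrier := S\<rparr>)" "\<And>s. s \<in> S \<Longrightarrow> \<eta> s = s"
    unfolding group_retract_def by blast
  define \<psi> where "\<psi> = inv_into R \<phi>"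
  have \<phi>: "\<phi> \<in> hom (P\<lparr>carrier := R\<rparr>) (Q\<lparr>carrier := S\<rparr>)" "bij_betw \<phi> R S"
    using assms(5) by (auto simp: iso_def)
  have \<psi>: "\<psi> \<in> hom (Q\<lparr>carrier := S\<rparr>) (P\<lparr>carrier := R\<rparr>)"
    using group.iso_set_sym[OF group.subgroup_imp_group[OF assms(1) R] assms(5)]
    by (simp add: \<psi>_def iso_def)
  have to_Q: "\<phi> \<circ> \<rho> \<in> hom P (Q\<lparr>carrier := S\<rparr>)" by (rule hom_compose[OF \<rho>(1) \<phi>(1)])
  have to_P: "\<psi> \<circ> \<eta> \<in> hom Q (P\<lparr>carrier := R\<rparr>)" by (rule hom_compose[OF \<eta>(1) \<psi>])
  \<comment> \<open>Each retraction is followed by the isomorphism out of its image, which extends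
    \<phi> and \<psi> to the whole factors.\<close>
  have "retract_amalgam P Q R \<phi> (\<phi> \<circ> \<rho>) (\<psi> \<circ> \<eta>)"
    unfolding retract_amalgam_def retract_amalgam_axioms_def
  proof (intro conjI allI impI)
    show "R \<subseteq> carrier P" using R by (rule subgroup.subset)
    show "\<phi> \<circ> \<rho> \<in> hom P Q" using to_Q subgroup.subset[OF S] by (auto simp: hom_def)
    show "\<psi> \<circ> \<eta> \<in> hom Q P" using to_P subgroup.subset[OF R] by (auto simp: hom_def)
    show "(\<phi> \<circ> \<rho>) p \<in> \<phi> ` R" if "p \<in> carrier P" for p
      using \<rho>(1) that by (auto simp: hom_def)
    show "(\<psi> \<circ> \<eta>) q \<in> R" if "q \<in> carrier Q" for q
      using to_P that by (auto simp: hom_def)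
    show "(\<psi> \<circ> \<eta>) (\<phi> r) = r" if "r \<in> R" for r
      using that \<eta>(2)[of "\<phi> r"] \<phi>(2) bij_betwE[OF \<phi>(2)] bij_betw_inv_into_left[OF \<phi>(2)]
      by (simp add: \<psi>_def)
  qed (use assms \<rho>(2) in auto)
  then show ?thesis by (rule retract_amalgam.has_VRC_amalgam)
qed

end
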